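(* For any $n,m\ge 1$, $\sigma\in S_n$, $\tau\in S_m$, and $1\le i\le n$, $$M_\sigma\circ_i M_\tau=\sum_{B_i(\sigma,\tau)\le\rho\le T_i(\sigma,\tau)}M_\rho ,$$ where the sum is over all $\rho\in S_{n+m-1}$ lying in the indicated interval of the weak order.
   Context: $\Bbbk$ is a commutative ring; "space" means $\Bbbk$-module. $[n]=\{1,\dots,n\}$, $S_n$ is the group of bijections of $[n]$, and $\sigma=(\sigma_1,\dots,\sigma_n)$ denotes the permutation with $\sigma(j)=\sigma_j$. For integers $a,b$, $[a,b]$ is the set of integers $x$ with $a\le x\le b$ (empty if $a>b$). For a sequence $a$ of distinct integers of length $n$, $\{a\}$ is its underlying set and its standardization $\mathrm{st}(a)\in S_n$ is the unique permutation with $\mathrm{st}(a)_p<\mathrm{st}(a)_q\iff a_p<a_q$. Definition of $B_i$. For $\sigma\in S_n,\tau\in S_m$, $i\in[n]$: $B_i(\sigma,\tau):=(a_1,\dots,a_{i-1},b_1,\dots,b_m,a_{i+1},\dots,a_n)\in S_{n+m-1}$, where $a_j=\sigma_j$ if $\sigma_j<\sigma_i$, $a_j=\sigma_j+m-1$ if $\sigma_j>\sigma_i$, and $b_k=\tau_k+\sigma_i-1$. Operad. $\mathcal A_n:=\Bbbk S_n$ has basis $\{F_\sigma\}_{\sigma\in S_n}$, and $\circ_i:\mathcal A_n\otimes\mathcal A_m\to\mathcal A_{n+m-1}$ is the linear map $F_\sigma\circ_iF_\tau=F_{B_i(\sigma,\tau)}$ (the non-symmetric associative operad). Weak order. $\mathrm{Inv}(\sigma)=\{(p,q):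 p<q,\ \sigma_p>\sigma_q\}$, and $\sigma\le\tau$ in $S_n$ iff $\mathrm{Inv}(\sigma)\subseteq\mathrm{Inv}(\tau)$. With $\mu$ the Möbius function of this poset, $M_\sigma:=\sum_{\sigma\le\tau}\mu(\sigma,\tau)F_\tau$. Definition of $T_i:S_n\times S_m\to S_{n+m-1}$ ($n,m,i$ fixed). For $\rho\in S_{n+m-1}$ let $\mathcal L_1(\rho)=(\rho_1,\dots,\rho_{i-1})$, $\mathcal L_2(\rho)=(\rho_i,\dots,\rho_{i+m-1})$, $\mathcal L_3(\rho)=(\rho_{i+m},\dots,\rho_{n+m-1})$. If $m=1$, $T_i(\sigma,1):=\sigma$. If $m>1$, let $L_j:=\mathcal L_j(B_i(\sigma,\tau))$, $\eta_i:=\sigma_i+m-1$, $$k_\sigma:=\max\{j\in[0,i-1]: [\sigma_i-j,\sigma_i]\subseteq\{L_1\}\cup\{\sigma_i\}\},\quad l_\sigma:=\max\{j\in[0,n-i]:[\eta_i,\eta_i+j]\subseteq\{\eta_i\}\cup\{L_3\}\},$$ $A_{1,b}^\sigma:=\{x\in\{L_1\}:x<\sigma_i-k_\sigma\}$, $A_{1,t}^\sigma:=\{x\in\{L_1\}:x>\sigma_i\}$, $A_{3,b}^\sigma:=\{x\in\{L_3\}:x<\eta_i\}$, $A_{3,t}^\sigma:=\{x\in\{L_3\}:x>\eta_i+l_\sigma\}$. Then $T_i(\sigma,\tau)$ is the unique permutation in $S_{n+m-1}$ whose sequences $L_j':=\mathcal L_j(T_i(\sigma,\tau))$ satisfy $\mathrm{st}(L'_j)=\mathrm{st}(L_j)$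 for $j=1,2,3$ and $$\{L_1'\}=A_{1,b}^\sigma\cup[\eta_i+l_\sigma-k_\sigma,\ \eta_i+l_\sigma-1]\cup A_{1,t}^\sigma,$$ $$\{L_2'\}=\{\sigma_i-k_\sigma\}\cup[\sigma_i-k_\sigma+l_\sigma+1,\ \eta_i+l_\sigma-k_\sigma-1]\cup\{\eta_i+l_\sigma\},$$ $$\{L_3'\}=A_{3,b}^\sigma\cup[\sigma_i-k_\sigma+1,\ \sigma_i-k_\sigma+l_\sigma]\cup A_{3,t}^\sigma.$$ *)

theory Defs
  imports Complex_Main "HOL-Library.Poly_Mapping" "HOL-Combinatorics.Permutations"
begin

section \<open>Permutations and the weak order\<close>

text \<open>
  \<^term>\<open>\<sigma> j\<close> is the \<open>j\<close>-th entry of the one-line notation of \<open>\<sigma>\<close>, with indices starting at 1.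
  As \<^const>\<open>permutes\<close> makes \<open>\<sigma>\<close> the identity outside \<open>{1..n}\<close>, the functions
  in \<open>Sym n\<close> are in bijection with the permutations of \<open>{1..n}\<close>.  But one function lies in
  \<open>Sym n\<close> for many \<open>n\<close>, so \<open>n\<close> is an explicit argument below.
\<close>

definition Sym :: "nat \<Rightarrow> (nat \<Rightarrow> nat) set" where
  "Sym n = {\<sigma>. \<sigma> permutes {1..n}}"

definition Inv :: "nat \<Rightarrow> (nat \<Rightarrow> nat) \<Rightarrow> (nat \<times> nat) set" where
  "Inv n \<sigma> = {(p, q). p \<in> {1..n} \<and> q \<in> {1..n} \<and> p < q \<and> \<sigma> p > \<sigma> q}"

definition weak_order :: "nat \<Rightarrow> (nat \<Rightarrow> nat) rel" where
  "weak_order n = {(\<sigma>, \<tau>). \<sigma> \<in> Sym n \<and> \<tau> \<in> Sym n \<and> Inv n \<sigma> \<subseteq> Inv n \<tau>}"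

lemma finite_Sym [simp]: "finite (Sym n)"
  unfolding Sym_def by (rule finite_permutations) simp

lemma finite_weak_order: "finite (weak_order n)"
  by (rule finite_subset[of _ "Sym n \<times> Sym n"]) (auto simp: weak_order_def)

lemma Sym_eq_card:
  assumes "\<sigma> \<in> Sym n" "p \<in> {1..n}"
  shows "\<sigma> p = card {q \<in> {1..n}. \<sigma> q \<le> \<sigma> p}"
proof -
  have perm: "\<sigma> permutes {1..n}" using assms(1) by (simp add: Sym_def)
  have le: "\<sigma> p \<le> n" using permutes_in_image[OF perm, of p] assms(2) by auto
  have "\<sigma> ` {q \<in> {1..n}. \<sigma> q \<le> \<sigma> p} = {1..\<sigma> p}"
  proof (rule set_eqI)
    fix y
    show "y \<in> \<sigma> ` {q \<in> {1..n}. \<sigma> q \<le> \<sigma> p} \<longleftrightarrow> y \<in> {1..\<sigma> p}"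
    proof
      assume "y \<in> \<sigma> ` {q \<in> {1..n}. \<sigma> q \<le> \<sigma> p}"
      then obtain q where q: "q \<in> {1..n}" "\<sigma> q \<le> \<sigma> p" "y = \<sigma> q" by auto
      show "y \<in> {1..\<sigma> p}" using permutes_in_image[OF perm, of q] q by auto
    next
      assume y: "y \<in> {1..\<sigma> p}"
      then have "y \<in> \<sigma> ` {1..n}" using permutes_image[OF perm] le by auto
      then show "y \<in> \<sigma> ` {q \<in> {1..n}. \<sigma> q \<le> \<sigma> p}" using y by auto
    qed
  qed
  moreover have "inj_on \<sigma> {q \<in> {1..n}. \<sigma> q \<le> \<sigma> p}"
    using permutes_inj[OF perm] by (rule inj_on_subset) simp
  ultimately show ?thesis by (metis card_atLeastAtMost card_image diff_Suc_1)
qed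

lemma Inv_le_iff:
  assumes "\<sigma> \<in> Sym n" "p \<in> {1..n}" "q \<in> {1..n}"
  shows "\<sigma> q \<le> \<sigma> p \<longleftrightarrow> q = p \<or> (q < p \<and> (q, p) \<notin> Inv n \<sigma>) \<or> (p, q) \<in> Inv n \<sigma>"
proof -
  have "inj \<sigma>" using assms(1) permutes_inj by (auto simp: Sym_def)
  then have "\<sigma> q = \<sigma> p \<longleftrightarrow> q = p" by (simp add: inj_eq)
  then show ?thesis using assms(2,3) unfolding Inv_def by (cases q p rule: linorder_cases) auto
qed

lemma Inv_inject:
  assumes "\<sigma> \<in> Sym n" "\<tau> \<in> Sym n" "Inv n \<sigma> = Inv n \<tau>"
  shows "\<sigma> = \<tau>"
proof
  fix p
  show "\<sigma> p = \<tau> p"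
  proof (cases "p \<in> {1..n}")
    case True
    have "{q \<in> {1..n}. \<sigma> q \<le> \<sigma> p} = {q \<in> {1..n}. \<tau> q \<le> \<tau> p}"
      using Inv_le_iff[OF assms(1) True] Inv_le_iff[OF assms(2) True] assms(3) by auto
    then show ?thesis using Sym_eq_card[OF assms(1) True] Sym_eq_card[OF assms(2) True] by simp
  next
    case False
    then show ?thesis using assms(1,2) by (simp add: Sym_def permutes_not_in)
  qed
qed

lemma Field_weak_order: "Field (weak_order n) = Sym n"
  by (auto simp: Field_def weak_order_def)

lemma Partial_order_weak_order: "Partial_order (weak_order n)"
  unfolding partial_order_on_def preorder_on_def Field_weak_order
  by (auto simp: refl_on_def trans_def antisym_def weak_order_def intro: Inv_inject)

section \<open>The Moebius function of a finite poset\<close>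

text \<open>The order is given by its graph \<open>r\<close>.  Only the values for a finite partial order matter; the
  guard makes the recursion terminate.\<close>

function moebius :: "'a rel \<Rightarrow> 'a \<Rightarrow> 'a \<Rightarrow> int" where
  "moebius r x y =
    (if finite r \<and> Partial_order r \<and> (x, y) \<in> r then
       if x = y then 1
       else - (\<Sum>z | (x, z) \<in> r \<and> (z, y) \<in> r \<and> z \<noteq> y. moebius r x z)
     else 0)"
  by auto
termination
proof (relation "measure (\<lambda>(r, x, y). card {w. (w, y) \<in> r})", simp, clarsimp)
  fix r :: "'a rel" and x y z
  assume fin: "finite r" and po: "Partial_order r" and zy: "(z, y) \<in> r" "z \<noteq> y"
  have "{w. (w, z) \<in> r} \<subset> {w. (w, y) \<in> r}"
  proof
    show "{w. (w, z) \<in> r} \<subseteq> {w. (w, y) \<in> r}"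
      using po zy unfolding partial_order_on_def preorder_on_def trans_def by blast
    have "(y, y) \<in> r" "(y, z) \<notin> r"
      using po zy
      unfolding partial_order_on_def preorder_on_def antisym_def refl_on_def Field_def
      by blast+
    then show "{w. (w, z) \<in> r} \<noteq> {w. (w, y) \<in> r}" by blast
  qed
  moreover have "finite {w. (w, y) \<in> r}"
    by (rule finite_subset[of _ "fst ` r"]) (force simp: fin)+
  ultimately show "card {w. (w, z) \<in> r} < card {w. (w, y) \<in> r}"
    by (rule psubset_card_mono[rotated])
qed

declare moebius.simps [simp del]

section \<open>The operad\<close>

text \<open>
  \<open>(nat \<Rightarrow> nat) \<Rightarrow>\<^sub>0 'k\<close> is the free module on all functions \<open>nat \<Rightarrow> nat\<close>; the module
  of arity \<open>n\<close> is its submodule spanned by the \<open>F \<sigma>\<close> with \<open>\<sigma> \<in> Sym n\<close>.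
\<close>

definition scale :: "'k::comm_ring_1 \<Rightarrow> ('a \<Rightarrow>\<^sub>0 'k) \<Rightarrow> ('a \<Rightarrow>\<^sub>0 'k)" where
  "scale c x = Poly_Mapping.map ((*) c) x"

lemma lookup_scale [simp]: "Poly_Mapping.lookup (scale c x) a = c * Poly_Mapping.lookup x a"
  unfolding scale_def by (simp add: Poly_Mapping.map.rep_eq when_def)

lemma module_scale: "module (scale :: 'k::comm_ring_1 \<Rightarrow> ('a \<Rightarrow>\<^sub>0 'k) \<Rightarrow> _)"
  by (rule module.intro) (auto intro!: poly_mapping_eqI simp: lookup_add algebra_simps)

definition F :: "(nat \<Rightarrow> nat) \<Rightarrow> ((nat \<Rightarrow> nat) \<Rightarrow>\<^sub>0 'k::comm_ring_1)" where
  "F \<sigma> = Poly_Mapping.single \<sigma> 1"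

text \<open>\<open>n\<close> and \<open>m\<close> are the sizes of \<open>\<sigma>\<close> and \<open>\<tau>\<close>.  Subtractions on \<^typ>\<open>nat\<close> do not truncate
  in the range \<open>1 \<le> i \<le> n\<close>, \<open>1 \<le> m\<close>.\<close>

definition B :: "nat \<Rightarrow> nat \<Rightarrow> nat \<Rightarrow> (nat \<Rightarrow> nat) \<Rightarrow> (nat \<Rightarrow> nat) \<Rightarrow> (nat \<Rightarrow> nat)" where
  "B n m i \<sigma> \<tau> =
    (let a = (\<lambda>j. if \<sigma> j < \<sigma> i then \<sigma> j else \<sigma> j + m - 1);
         b = (\<lambda>k. \<tau> k + \<sigma> i - 1)
     in (\<lambda>p. if p \<in> {1..<i} then a p
             else if p \<in> {i..<i + m} then b (p + 1 - i)
             else if p \<in> {i + m..<n + m} then a (p + 1 - m)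
             else p))"

definition partial_comp :: "nat \<Rightarrow> nat \<Rightarrow> nat \<Rightarrow> ((nat \<Rightarrow> nat) \<Rightarrow>\<^sub>0 'k::comm_ring_1)
    \<Rightarrow> ((nat \<Rightarrow> nat) \<Rightarrow>\<^sub>0 'k) \<Rightarrow> ((nat \<Rightarrow> nat) \<Rightarrow>\<^sub>0 'k)" where
  "partial_comp n m i x y =
    (\<Sum>\<sigma>\<in>Sym n. \<Sum>\<tau>\<in>Sym m.
       scale (Poly_Mapping.lookup x \<sigma> * Poly_Mapping.lookup y \<tau>) (F (B n m i \<sigma> \<tau>)))"

lemma partial_comp_F:
  assumes "\<sigma> \<in> Sym n" "\<tau> \<in> Sym m"
  shows "partial_comp n m i (F \<sigma>) (F \<tau>) = (F (B n m i \<sigma> \<tau>) :: (nat \<Rightarrow> nat) \<Rightarrow>\<^sub>0 'k::comm_ring_1)"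
proof -
  have "scale (Poly_Mapping.lookup (F \<sigma>) \<sigma>' * Poly_Mapping.lookup (F \<tau>) \<tau>') x =
      (if \<sigma>' = \<sigma> then if \<tau>' = \<tau> then x else 0 else 0)"
    for \<sigma>' \<tau>' and x :: "(nat \<Rightarrow> nat) \<Rightarrow>\<^sub>0 'k"
    by (rule poly_mapping_eqI) (auto simp: F_def lookup_single when_def)
  then have "partial_comp n m i (F \<sigma>) (F \<tau>) =
      (\<Sum>\<sigma>'\<in>Sym n. if \<sigma>' = \<sigma> then (\<Sum>\<tau>'\<in>Sym m. if \<tau>' = \<tau>
          then (F (B n m i \<sigma>' \<tau>') :: _ \<Rightarrow>\<^sub>0 'k) else 0) else 0)"
    unfolding partial_comp_def by (intro sum.cong refl) simp
  then show ?thesis using assms by simp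
qed

lemma partial_comp_add_left: "partial_comp n m i (x + x') y = partial_comp n m i x y + partial_comp n m i x' y"
  by (rule poly_mapping_eqI)
    (simp add: partial_comp_def lookup_sum lookup_add algebra_simps sum.distrib)

lemma partial_comp_add_right: "partial_comp n m i x (y + y') = partial_comp n m i x y + partial_comp n m i x y'"
  by (rule poly_mapping_eqI)
    (simp add: partial_comp_def lookup_sum lookup_add algebra_simps sum.distrib)

lemma partial_comp_scale_left: "partial_comp n m i (scale c x) y = scale c (partial_comp n m i x y)"
  by (rule poly_mapping_eqI)
    (simp add: partial_comp_def lookup_sum sum_distrib_left algebra_simps)

lemma partial_comp_scale_right: "partial_comp n m i x (scale c y) = scale c (partial_comp n m i x y)"
  by (rule poly_mapping_eqI)
    (simp add: partial_comp_def lookup_sum sum_distrib_left algebra_simps)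

definition M :: "nat \<Rightarrow> (nat \<Rightarrow> nat) \<Rightarrow> ((nat \<Rightarrow> nat) \<Rightarrow>\<^sub>0 'k::comm_ring_1)" where
  "M n \<sigma> = (\<Sum>\<tau> | (\<sigma>, \<tau>) \<in> weak_order n. scale (of_int (moebius (weak_order n) \<sigma> \<tau>)) (F \<tau>))"

section \<open>The upper bound of the interval\<close>

text \<open>Sequences are lists; list positions start at 0, hence the index shift.\<close>

definition st :: "int list \<Rightarrow> (nat \<Rightarrow> nat)" where
  "st a = (THE \<pi>. \<pi> \<in> Sym (length a) \<and>
     (\<forall>p\<in>{1..length a}. \<forall>q\<in>{1..length a}. \<pi> p < \<pi> q \<longleftrightarrow> a ! (p - 1) < a ! (q - 1)))"

definition seq1 :: "nat \<Rightarrow> nat \<Rightarrow> nat \<Rightarrow> (nat \<Rightarrow> nat) \<Rightarrow> int list" where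
  "seq1 n m i \<rho> = map (\<lambda>p. int (\<rho> p)) [1..<i]"

definition seq2 :: "nat \<Rightarrow> nat \<Rightarrow> nat \<Rightarrow> (nat \<Rightarrow> nat) \<Rightarrow> int list" where
  "seq2 n m i \<rho> = map (\<lambda>p. int (\<rho> p)) [i..<i + m]"

definition seq3 :: "nat \<Rightarrow> nat \<Rightarrow> nat \<Rightarrow> (nat \<Rightarrow> nat) \<Rightarrow> int list" where
  "seq3 n m i \<rho> = map (\<lambda>p. int (\<rho> p)) [i + m..<n + m]"

text \<open>Values are taken in \<^typ>\<open>int\<close>, so that interval bounds such as \<open>s - k\<close> do not truncate.
  Below, \<open>s\<close> stands for \<open>\<sigma> i\<close> and \<open>e\<close> for \<open>\<eta>\<^sub>i\<close>.\<close>

definition T :: "nat \<Rightarrow> nat \<Rightarrow> nat \<Rightarrow> (nat \<Rightarrow> nat) \<Rightarrow> (nat \<Rightarrow> nat) \<Rightarrow> (nat \<Rightarrow> nat)" where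
  "T n m i \<sigma> \<tau> =
    (if m = 1 then \<sigma> else
     let L1 = seq1 n m i (B n m i \<sigma> \<tau>);
         L2 = seq2 n m i (B n m i \<sigma> \<tau>);
         L3 = seq3 n m i (B n m i \<sigma> \<tau>);
         s = int (\<sigma> i);
         e = s + int m - 1;
         k = int (Max {j \<in> {0..i - 1}. {s - int j..s} \<subseteq> set L1 \<union> {s}});
         l = int (Max {j \<in> {0..n - i}. {e..e + int j} \<subseteq> {e} \<union> set L3});
         A1b = {x \<in> set L1. x < s - k};
         A1t = {x \<in> set L1. x > s};
         A3b = {x \<in> set L3. x < e};
         A3t = {x \<in> set L3. x > e + l}
     in THE \<rho>. \<rho> \<in> Sym (n + m - 1) \<and>
          st (seq1 n m i \<rho>) = st L1 \<and>
          st (seq2 n m i \<rho>) = st L2 \<and>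
          st (seq3 n m i \<rho>) = st L3 \<and>
          set (seq1 n m i \<rho>) = A1b \<union> {e + l - k..e + l - 1} \<union> A1t \<and>
          set (seq2 n m i \<rho>) = {s - k} \<union> {s - k + l + 1..e + l - k - 1} \<union> {e + l} \<and>
          set (seq3 n m i \<rho>) = A3b \<union> {s - k + 1..s - k + l} \<union> A3t)"

end

theory Submission
  imports Defs "HOL-Library.Product_Lexorder"
begin

text \<open>
  The proof compares coefficients in the basis of the elements \<open>M\<close>.  By Moebius inversion
  (\<open>F_as_sum_of_M\<close>), \<open>F \<pi>\<close> is the sum of the \<open>M \<rho>\<close> with \<open>\<pi> \<le> \<rho>\<close>, so the product
  of \<open>M \<sigma>\<close> and \<open>M \<tau>\<close> is a sum of multiples of \<open>M \<rho>\<close>, where \<open>\<rho>\<close> receives a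
  contribution from each pair \<open>(\<sigma>', \<tau>') \<ge> (\<sigma>, \<tau>)\<close> with \<open>B \<sigma>' \<tau>' \<le> \<rho>\<close>.

  The map \<open>B\<close> from pairs to permutations has an upper adjoint (\<open>adjunction\<close>): for every \<open>\<rho>\<close>
  there is a pair \<open>(outer \<rho>, inner \<rho>)\<close> such that \<open>B \<sigma>' \<tau>' \<le> \<rho>\<close> iff
  \<open>\<sigma>' \<le> outer \<rho>\<close> and \<open>\<tau>' \<le> inner \<rho>\<close>.  Here \<open>inner \<rho>\<close> is the pattern of \<open>\<rho>\<close>
  on the block of positions of \<open>\<tau>\<close>, and \<open>outer \<rho>\<close> is \<open>\<rho>\<close> with the block contracted
  to a point and with as many inversions as \<open>\<rho>\<close> permits.  The contributions to
  \<open>\<rho>\<close> are therefore products of Moebius values summed over two intervals, and by the defining property of the Moebius function they cancel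
  unless \<open>\<sigma> = outer \<rho>\<close> and \<open>\<tau> = inner \<rho>\<close> (\<open>partial_comp_M_M\<close>).

  It remains to see that the fibre of the adjoint over \<open>(\<sigma>, \<tau>)\<close> is the interval from
  \<open>B \<sigma> \<tau>\<close> to \<open>T \<sigma> \<tau>\<close>.  The lower end is immediate.  In the fibre, an entry left of
  the block that comes from a value below \<open>\<sigma> i\<close> stays below the largest block entry, and an
  entry right of the block that comes from a value above \<open>\<sigma> i\<close> stays above the smallest one.
  Only the entries in the runs of consecutive values next to the block can pass block entries, and
  the extreme case, where each of them passes all but one, gives the largest element of the fibre
  (\<open>interval_iff\<close>).  An explicit relabelling of the values of \<open>B \<sigma> \<tau>\<close> has exactly these
  inversions (\<open>upper_compare\<close>) and satisfies the conditions that define \<open>T \<sigma> \<tau>\<close>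
  (\<open>T_eq_upper\<close>).
\<close>

section \<open>Moebius inversion on a finite poset\<close>

lemma moebius_outside: "(x, y) \<notin> r \<Longrightarrow> moebius r x y = 0"
  by (simp add: moebius.simps)

definition zeta :: "'a rel \<Rightarrow> 'a \<Rightarrow> 'a \<Rightarrow> int" where
  "zeta r x y = of_bool ((x, y) \<in> r)"

text \<open>This inverse property is the recursive definition itself: for \<open>x < y\<close> the
  values of \<open>moebius r x\<close> on the interval from \<open>x\<close> to \<open>y\<close> sum to zero.\<close>
lemma moebius_zeta:
  assumes "finite r" "Partial_order r" "x \<in> Field r"
  shows "(\<Sum>z\<in>Field r. moebius r x z * zeta r z y) = of_bool (x = y)"
proof -
  have refl: "(x, x) \<in> r" and Fr: "finite (Field r)"
    using assms by (auto simp: partial_order_on_def preorder_on_def refl_on_def finite_Field)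
  have tr: "(a, c) \<in> r" if "(a, b) \<in> r" "(b, c) \<in> r" for a b c
    using assms(2) that unfolding partial_order_on_def preorder_on_def trans_def by blast
  have "(\<Sum>z\<in>Field r. moebius r x z * zeta r z y) =
        (\<Sum>z | (x, z) \<in> r \<and> (z, y) \<in> r. moebius r x z)"
  proof (intro sum.mono_neutral_cong_right Fr ballI)
    show "{z. (x, z) \<in> r \<and> (z, y) \<in> r} \<subseteq> Field r" by (auto simp: Field_def)
  next
    fix z assume "z \<in> Field r - {z. (x, z) \<in> r \<and> (z, y) \<in> r}"
    then show "moebius r x z * zeta r z y = 0"
      using moebius_outside[of x z r] by (auto simp: zeta_def)
  qed (simp add: zeta_def)
  also have "\<dots> = of_bool (x = y)"
  proof (cases "(x, y) \<in> r")
    case True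
    have yy: "(y, y) \<in> r"
      using assms(2) True by (auto simp: partial_order_on_def preorder_on_def refl_on_def FieldI2)
    have fin: "finite {z. (x, z) \<in> r \<and> (z, y) \<in> r}"
      by (rule finite_subset[OF _ Fr]) (auto intro: FieldI1)
    show ?thesis
    proof (cases "x = y")
      case True
      then have "{z. (x, z) \<in> r \<and> (z, y) \<in> r} = {x}"
        using assms(2) refl unfolding partial_order_on_def antisym_def by blast
      then show ?thesis using True assms refl by (simp add: moebius.simps)
    next
      case False
      have "{z. (x, z) \<in> r \<and> (z, y) \<in> r} = insert y {z. (x, z) \<in> r \<and> (z, y) \<in> r \<and> z \<noteq> y}"
        using True yy by auto
      moreover have "moebius r x y = - (\<Sum>z | (x, z) \<in> r \<and> (z, y) \<in> r \<and> z \<noteq> y. moebius r x z)"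
        using True False assms by (subst moebius.simps) simp
      ultimately show ?thesis using False fin by simp
    qed
  next
    case False
    then have "{z. (x, z) \<in> r \<and> (z, y) \<in> r} = {}" using tr by blast
    then show ?thesis using False refl by (auto simp del: Collect_empty_eq)
  qed
  finally show ?thesis .
qed

text \<open>A one-sided inverse of a unitriangular matrix is two-sided.  Write \<open>f z\<close> for the sum at \<open>z\<close>.
  By the other identity, \<open>f\<close> and \<open>\<lambda>z. of_bool (z = y)\<close> give the same sum against
  \<open>moebius r x\<close>; by induction from the top of the poset they agree at every \<open>z\<close> strictly
  above \<open>x\<close>, so the one remaining term, at \<open>z = x\<close>, vanishes as well.\<close>
lemma zeta_moebius:
  assumes fin: "finite r" and po: "Partial_order r" and "x \<in> Field r"
  shows "(\<Sum>z\<in>Field r. zeta r x z * moebius r z y) = of_bool (x = y)"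
  using \<open>x \<in> Field r\<close>
proof (induction "card {w. (x, w) \<in> r}" arbitrary: x rule: less_induct)
  case less
  let ?f = "\<lambda>x. \<Sum>z\<in>Field r. zeta r x z * moebius r z y"
  have Fr: "finite (Field r)" using fin by (rule finite_Field)
  have IH: "?f z = of_bool (z = y)" if "(x, z) \<in> r" "z \<noteq> x" for z
  proof (rule less(1))
    have "(x, x) \<in> r" "(z, x) \<notin> r"
      using po that less(2) unfolding partial_order_on_def preorder_on_def refl_on_def antisym_def
      by blast+
    moreover have "{w. (z, w) \<in> r} \<subseteq> {w. (x, w) \<in> r}"
      using po that unfolding partial_order_on_def preorder_on_def trans_def by blast
    ultimately have "{w. (z, w) \<in> r} \<subset> {w. (x, w) \<in> r}" by blast
    moreover have "finite {w. (x, w) \<in> r}" by (rule finite_subset[OF _ Fr]) (auto intro: FieldI2)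
    ultimately show "card {w. (z, w) \<in> r} < card {w. (x, w) \<in> r}" by (rule psubset_card_mono[rotated])
    show "z \<in> Field r" using that by (auto intro: FieldI2)
  qed
  have "(\<Sum>z\<in>Field r. moebius r x z * ?f z) =
        (\<Sum>w\<in>Field r. (\<Sum>z\<in>Field r. moebius r x z * zeta r z w) * moebius r w y)"
    unfolding sum_distrib_left sum_distrib_right
    by (subst sum.swap) (simp add: mult.assoc)
  also have "\<dots> = moebius r x y"
    using Fr less(2) by (simp add: moebius_zeta[OF fin po less(2)] of_bool_def if_distrib if_distribR cong: if_cong)
  also have "\<dots> = (\<Sum>z\<in>Field r. moebius r x z * of_bool (z = y))"
    using Fr by (cases "y \<in> Field r")
      (auto simp: of_bool_def if_distrib cong: if_cong intro: moebius_outside FieldI2)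
  finally have "0 = (\<Sum>z\<in>Field r. moebius r x z * (?f z - of_bool (z = y)))"
    by (simp add: right_diff_distrib sum_subtractf)
  also have "\<dots> = (\<Sum>z\<in>{x}. moebius r x z * (?f z - of_bool (z = y)))"
  proof (intro sum.mono_neutral_right ballI)
    fix z assume "z \<in> Field r - {x}"
    then show "moebius r x z * (?f z - of_bool (z = y)) = 0"
      using IH[of z] moebius_outside[of x z r] by (cases "(x, z) \<in> r") simp_all
  qed (use less(2) Fr in auto)
  also have "\<dots> = ?f x - of_bool (x = y)"
  proof -
    have "(x, x) \<in> r" using po less(2) by (auto simp: partial_order_on_def preorder_on_def refl_on_def)
    then have "moebius r x x = 1" using fin po by (simp add: moebius.simps)
    then show ?thesis by simp
  qed
  finally show ?case by simp
qed

section \<open>Reduction to a statement about the weak order\<close>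

lemma lookup_F: "Poly_Mapping.lookup (F \<sigma>) \<chi> = of_bool (\<sigma> = \<chi>)"
  by (simp add: F_def lookup_single when_def of_bool_def)

lemma lookup_M:
  "Poly_Mapping.lookup (M n \<sigma> :: _ \<Rightarrow>\<^sub>0 'k::comm_ring_1) \<chi> = of_int (moebius (weak_order n) \<sigma> \<chi>)"
proof -
  have "finite {\<tau>. (\<sigma>, \<tau>) \<in> weak_order n}"
    by (rule finite_subset[OF _ finite_Sym[of n]]) (auto simp: weak_order_def)
  then show ?thesis
    by (auto simp: M_def lookup_sum lookup_F of_bool_def if_distrib moebius_outside cong: if_cong)
qed

lemma F_as_sum_of_M:
  assumes "\<pi> \<in> Sym n"
  shows "(F \<pi> :: _ \<Rightarrow>\<^sub>0 'k::comm_ring_1) = (\<Sum>\<rho>\<in>Sym n. scale (of_int (zeta (weak_order n) \<pi> \<rho>)) (M n \<rho>))"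
proof (rule poly_mapping_eqI)
  fix \<chi>
  have "(of_bool (\<pi> = \<chi>) :: 'k) = of_int (of_bool (\<pi> = \<chi>))" by simp
  also have "\<dots> = (\<Sum>\<rho>\<in>Sym n. of_int (zeta (weak_order n) \<pi> \<rho>) * of_int (moebius (weak_order n) \<rho> \<chi>))"
    using zeta_moebius[OF finite_weak_order Partial_order_weak_order, of \<pi> n \<chi>] assms
    unfolding Field_weak_order by (metis (no_types, lifting) of_int_mult of_int_sum sum.cong)
  finally show "Poly_Mapping.lookup (F \<pi> :: _ \<Rightarrow>\<^sub>0 'k) \<chi> =
      Poly_Mapping.lookup (\<Sum>\<rho>\<in>Sym n. scale (of_int (zeta (weak_order n) \<pi> \<rho>)) (M n \<rho>)) \<chi>"
    by (simp add: lookup_F lookup_sum lookup_M)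
qed

text \<open>Expand the product in the \<open>F\<close> basis and rewrite each \<open>F (B n m i \<sigma>' \<tau>')\<close> as a sum
  of elements \<open>M N \<rho>\<close>.  If the pairs \<open>(\<sigma>', \<tau>')\<close> that contribute to \<open>\<rho>\<close> are
  exactly those below \<open>(outer \<rho>, inner \<rho>)\<close>, the coefficient of \<open>M N \<rho>\<close> is a product of
  two sums of Moebius values, over the intervals from \<open>\<sigma>\<close> to \<open>outer \<rho>\<close> and from \<open>\<tau>\<close>
  to \<open>inner \<rho>\<close>.  Such a sum is 1 on a one-point interval and 0 otherwise.\<close>
lemma partial_comp_M_M:
  fixes outer inner :: "(nat \<Rightarrow> nat) \<Rightarrow> (nat \<Rightarrow> nat)"
  assumes \<sigma>: "\<sigma> \<in> Sym n" and \<tau>: "\<tau> \<in> Sym m"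
    and B: "\<And>\<sigma> \<tau>. \<sigma> \<in> Sym n \<Longrightarrow> \<tau> \<in> Sym m \<Longrightarrow> B n m i \<sigma> \<tau> \<in> Sym N"
    and adj: "\<And>\<sigma> \<tau> \<rho>. \<sigma> \<in> Sym n \<Longrightarrow> \<tau> \<in> Sym m \<Longrightarrow> \<rho> \<in> Sym N \<Longrightarrow>
      (B n m i \<sigma> \<tau>, \<rho>) \<in> weak_order N \<longleftrightarrow>
      (\<sigma>, outer \<rho>) \<in> weak_order n \<and> (\<tau>, inner \<rho>) \<in> weak_order m"
  shows "partial_comp n m i (M n \<sigma>) (M m \<tau>) =
    (\<Sum>\<rho> | \<rho> \<in> Sym N \<and> \<sigma> = outer \<rho> \<and> \<tau> = inner \<rho>. (M N \<rho> :: _ \<Rightarrow>\<^sub>0 'k::comm_ring_1))"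
proof (rule poly_mapping_eqI)
  fix \<chi>
  let ?m = "\<lambda>\<sigma>'. moebius (weak_order n) \<sigma> \<sigma>'" and ?m' = "\<lambda>\<tau>'. moebius (weak_order m) \<tau> \<tau>'"
  let ?z = "\<lambda>\<sigma>' \<rho>. zeta (weak_order n) \<sigma>' (outer \<rho>)" and ?z' = "\<lambda>\<tau>' \<rho>. zeta (weak_order m) \<tau>' (inner \<rho>)"
  let ?c = "\<lambda>\<rho>. moebius (weak_order N) \<rho> \<chi>"
  have FB: "Poly_Mapping.lookup (F (B n m i \<sigma>' \<tau>') :: _ \<Rightarrow>\<^sub>0 'k) \<chi> =
      of_int (\<Sum>\<rho>\<in>Sym N. ?z \<sigma>' \<rho> * ?z' \<tau>' \<rho> * ?c \<rho>)" if "\<sigma>' \<in> Sym n" "\<tau>' \<in> Sym m" for \<sigma>' \<tau>'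
    unfolding F_as_sum_of_M[OF B[OF that]]
    by (simp add: lookup_sum lookup_M) (intro sum.cong refl, simp add: zeta_def adj that of_bool_conj)
  have "Poly_Mapping.lookup (partial_comp n m i (M n \<sigma>) (M m \<tau>) :: _ \<Rightarrow>\<^sub>0 'k) \<chi> =
      (\<Sum>\<sigma>'\<in>Sym n. \<Sum>\<tau>'\<in>Sym m. of_int (?m \<sigma>' * ?m' \<tau>') * of_int (\<Sum>\<rho>\<in>Sym N. ?z \<sigma>' \<rho> * ?z' \<tau>' \<rho> * ?c \<rho>))"
    unfolding partial_comp_def lookup_sum lookup_scale lookup_M
    by (intro sum.cong refl) (simp add: FB)
  also have "\<dots> = of_int (\<Sum>\<sigma>'\<in>Sym n. \<Sum>\<tau>'\<in>Sym m. \<Sum>\<rho>\<in>Sym N.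
      ?c \<rho> * ((?m \<sigma>' * ?z \<sigma>' \<rho>) * (?m' \<tau>' * ?z' \<tau>' \<rho>)))"
    by (simp add: sum_distrib_left algebra_simps)
  also have "(\<Sum>\<sigma>'\<in>Sym n. \<Sum>\<tau>'\<in>Sym m. \<Sum>\<rho>\<in>Sym N. ?c \<rho> * ((?m \<sigma>' * ?z \<sigma>' \<rho>) * (?m' \<tau>' * ?z' \<tau>' \<rho>))) =
      (\<Sum>\<rho>\<in>Sym N. \<Sum>\<sigma>'\<in>Sym n. \<Sum>\<tau>'\<in>Sym m. ?c \<rho> * ((?m \<sigma>' * ?z \<sigma>' \<rho>) * (?m' \<tau>' * ?z' \<tau>' \<rho>)))"
    by (subst (2) sum.swap, subst sum.swap, rule refl)
  also have "\<dots> = (\<Sum>\<rho>\<in>Sym N. ?c \<rho> * ((\<Sum>\<sigma>'\<in>Sym n. ?m \<sigma>' * ?z \<sigma>' \<rho>) * (\<Sum>\<tau>'\<in>Sym m. ?m' \<tau>' * ?z' \<tau>' \<rho>)))"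
    unfolding sum_product by (simp only: sum_distrib_left)
  also have "\<dots> = (\<Sum>\<rho>\<in>Sym N. ?c \<rho> * (of_bool (\<sigma> = outer \<rho>) * of_bool (\<tau> = inner \<rho>)))"
    using moebius_zeta[OF finite_weak_order Partial_order_weak_order, of _ n]
      moebius_zeta[OF finite_weak_order Partial_order_weak_order, of _ m] \<sigma> \<tau>
    by (simp add: Field_weak_order)
  also have "\<dots> = (\<Sum>\<rho> | \<rho> \<in> Sym N \<and> \<sigma> = outer \<rho> \<and> \<tau> = inner \<rho>. ?c \<rho>)"
    by (intro sum.mono_neutral_cong_right) auto
  finally show "Poly_Mapping.lookup (partial_comp n m i (M n \<sigma>) (M m \<tau>) :: _ \<Rightarrow>\<^sub>0 'k) \<chi> =
    Poly_Mapping.lookup (\<Sum>\<rho> | \<rho> \<in> Sym N \<and> \<sigma> = outer \<rho> \<and> \<tau> = inner \<rho>. M N \<rho>) \<chi>"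
    by (simp add: lookup_sum lookup_M)
qed

section \<open>Permutations, weak order and standardization\<close>

lemma Sym_I:
  assumes "\<And>p. p \<in> {1..n} \<Longrightarrow> f p \<in> {1..n}" "inj_on f {1..n}" "\<And>p. p \<notin> {1..n} \<Longrightarrow> f p = p"
  shows "f \<in> Sym n"
proof -
  have "f ` {1..n} = {1..n}"
    using assms(1,2) by (intro endo_inj_surj) auto
  then have "bij_betw f {1..n} {1..n}" using assms(2) by (simp add: bij_betw_def)
  then show ?thesis using assms(3) by (auto simp: Sym_def intro: bij_imp_permutes)
qed

lemma Sym_inj: "\<sigma> \<in> Sym n \<Longrightarrow> \<sigma> p = \<sigma> q \<longleftrightarrow> p = q"
  by (auto simp: Sym_def dest: permutes_inj injD)

lemma Sym_in: "\<sigma> \<in> Sym n \<Longrightarrow> p \<in> {1..n} \<Longrightarrow> \<sigma> p \<in> {1..n}"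
  using permutes_in_image[of \<sigma> "{1..n}" p] by (simp add: Sym_def)

lemma Sym_surj: "\<sigma> \<in> Sym n \<Longrightarrow> v \<in> {1..n} \<Longrightarrow> \<exists>p\<in>{1..n}. \<sigma> p = v"
  using permutes_image[of \<sigma> "{1..n}"] unfolding Sym_def by (metis imageE mem_Collect_eq)

lemma weak_order_iff:
  "(\<sigma>, \<tau>) \<in> weak_order n \<longleftrightarrow> \<sigma> \<in> Sym n \<and> \<tau> \<in> Sym n \<and>
     (\<forall>p\<in>{1..n}. \<forall>q\<in>{1..n}. p < q \<longrightarrow> \<sigma> q < \<sigma> p \<longrightarrow> \<tau> q < \<tau> p)"
  by (auto simp: weak_order_def Inv_def subset_iff)

lemma weak_order_antisym: "(\<sigma>, \<tau>) \<in> weak_order n \<Longrightarrow> (\<tau>, \<sigma>) \<in> weak_order n \<Longrightarrow> \<sigma> = \<tau>"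
  by (auto simp: weak_order_def intro: Inv_inject)

lemma Sym_eq_of_same_order:
  assumes "\<sigma> \<in> Sym n" "\<tau> \<in> Sym n"
    and "\<And>p q. p \<in> {1..n} \<Longrightarrow> q \<in> {1..n} \<Longrightarrow> \<sigma> p < \<sigma> q \<longleftrightarrow> \<tau> p < \<tau> q"
  shows "\<sigma> = \<tau>"
  using assms by (intro Inv_inject[of _ n]) (auto simp: Inv_def)

text \<open>Ranking by a key.  The key may lie in any linear order; below it is a sequence entry, an entry
  of a permutation, or a lexicographically ordered pair.\<close>
definition rank :: "nat \<Rightarrow> (nat \<Rightarrow> 'a::linorder) \<Rightarrow> nat \<Rightarrow> nat" where
  "rank n f p = (if p \<in> {1..n} then card {q \<in> {1..n}. f q \<le> f p} else p)"

lemma rank_less_iff: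
  assumes "p \<in> {1..n}" "q \<in> {1..n}"
  shows "rank n f p < rank n f q \<longleftrightarrow> f p < f q"
proof -
  have less: "rank n f p < rank n f q" if "f p < f q" "p \<in> {1..n}" "q \<in> {1..n}" for p q
  proof -
    define S where "S x = {r \<in> {1..n}. f r \<le> x}" for x
    have "S (f p) \<subseteq> S (f q)"
      unfolding S_def using order.trans[OF _ less_imp_le[OF that(1)]] by blast
    moreover have "q \<in> S (f q)" "q \<notin> S (f p)" using that by (simp_all add: S_def)
    ultimately have "S (f p) \<subset> S (f q)" by blast
    moreover have "finite (S x)" for x by (simp add: S_def)
    ultimately have "card (S (f p)) < card (S (f q))" by (intro psubset_card_mono)
    then show ?thesis using that(2,3) by (simp add: rank_def S_def)
  qed
  show ?thesis
  proof (cases "f p" "f q" rule: linorder_cases)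
    case equal
    then show ?thesis using assms by (simp add: rank_def)
  qed (use assms less in \<open>fastforce dest: less_asym\<close>)+
qed

lemma rank_Sym:
  assumes "inj_on f {1..n}"
  shows "rank n f \<in> Sym n"
proof (rule Sym_I)
  fix p assume p: "p \<in> {1..n}"
  have "card {q \<in> {1..n}. f q \<le> f p} \<le> card {1..n}" by (intro card_mono) auto
  moreover have "card {q \<in> {1..n}. f q \<le> f p} > 0" using p by (auto simp: card_gt_0_iff)
  ultimately show "rank n f p \<in> {1..n}" using p by (simp add: rank_def Suc_le_eq)
next
  show "inj_on (rank n f) {1..n}"
  proof (rule inj_onI)
    fix p q assume pq: "p \<in> {1..n}" "q \<in> {1..n}" "rank n f p = rank n f q"
    then have "f p = f q" using rank_less_iff[of p n q f] rank_less_iff[of q n p f] by auto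
    then show "p = q" using assms pq by (auto dest: inj_onD)
  qed
qed (simp add: rank_def del: atLeastAtMost_iff)

lemma st_cong:
  assumes "length a = length b"
    and "\<And>p q. p < length a \<Longrightarrow> q < length a \<Longrightarrow> a ! p < a ! q \<longleftrightarrow> b ! p < b ! q"
  shows "st a = st b"
proof -
  have "a ! (p - 1) < a ! (q - 1) \<longleftrightarrow> b ! (p - 1) < b ! (q - 1)"
    if "p \<in> {1..length b}" "q \<in> {1..length b}" for p q
    using assms that by auto
  then show ?thesis unfolding st_def assms(1) by (metis (no_types, lifting))
qed

lemma st_less_iff:
  assumes "distinct a" "p < length a" "q < length a"
  shows "st a (Suc p) < st a (Suc q) \<longleftrightarrow> a ! p < a ! q"
proof -
  let ?P = "\<lambda>\<pi>. \<pi> \<in> Sym (length a) \<and>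
     (\<forall>p\<in>{1..length a}. \<forall>q\<in>{1..length a}. \<pi> p < \<pi> q \<longleftrightarrow> a ! (p - 1) < a ! (q - 1))"
  have "inj_on (\<lambda>p. a ! (p - 1)) {1..length a}"
    using assms(1) by (auto simp: inj_on_def nth_eq_iff_index_eq)
  then have "?P (rank (length a) (\<lambda>p. a ! (p - 1)))" by (simp add: rank_Sym rank_less_iff)
  moreover have "\<pi> = \<pi>'" if "?P \<pi>" "?P \<pi>'" for \<pi> \<pi>'
    using that by (auto intro: Sym_eq_of_same_order[of _ "length a"])
  ultimately have "\<exists>!\<pi>. ?P \<pi>" by blast
  then have "?P (st a)" unfolding st_def by (rule theI')
  then show ?thesis using assms by (auto simp: Ball_def Suc_le_eq)
qed

text \<open>For the maximal lengths of runs of consecutive values: a run contains all shorter ones.\<close>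
lemma le_Max_iff:
  fixes j b :: nat
  assumes "P 0" and mono: "\<And>j j'. P j' \<Longrightarrow> j \<le> j' \<Longrightarrow> P j"
  shows "j \<le> Max {j \<in> {0..b}. P j} \<longleftrightarrow> j \<le> b \<and> P j"
proof -
  let ?S = "{j \<in> {0..b}. P j}"
  have fin: "finite ?S" by simp
  have "0 \<in> ?S" using assms(1) by simp
  then have "Max ?S \<in> ?S" using Max_in[OF fin] by (metis empty_iff)
  then have max: "Max ?S \<le> b" "P (Max ?S)" by auto
  show ?thesis
  proof
    assume "j \<le> Max ?S"
    then show "j \<le> b \<and> P j" using max mono by (meson order.trans)
  next
    assume "j \<le> b \<and> P j"
    then show "j \<le> Max ?S" using fin by (intro Max_ge) simp_all
  qed
qed

text \<open>A sequence of distinct integers is determined by its standardization and its set of entries: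
  the former says how many entries lie below the one at a given position, and no two elements of
  a finite set of integers have the same number of elements of that set below them.\<close>
lemma eq_if_st_set_eq:
  assumes "distinct a" "distinct b" "st a = st b" "set a = set b"
  shows "a = b"
proof -
  have len: "length a = length b" using distinct_card[OF assms(1)] distinct_card[OF assms(2)] assms(4) by simp
  have less: "a ! p < a ! q \<longleftrightarrow> b ! p < b ! q" if "p < length a" "q < length a" for p q
    using st_less_iff[OF assms(1) that] st_less_iff[OF assms(2), of p q] that by (simp add: assms(3) len)
  have cnt: "card {x \<in> set c. x < c ! p} = card {q. q < length c \<and> c ! q < c ! p}"
    if "distinct c" for c :: "int list" and p
  proof -
    have "{x \<in> set c. x < c ! p} = (!) c ` {q. q < length c \<and> c ! q < c ! p}"
      unfolding set_conv_nth by blast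
    moreover have "inj_on ((!) c) {q. q < length c \<and> c ! q < c ! p}"
      using that by (auto simp: inj_on_def nth_eq_iff_index_eq)
    ultimately show ?thesis by (simp add: card_image)
  qed
  have mono: "card {x \<in> S. x < u} < card {x \<in> S. x < v}" if "finite S" "u < v" "u \<in> S"
    for S and u v :: int
    using that by (intro psubset_card_mono) auto
  show ?thesis
  proof (rule nth_equalityI[OF len])
    fix p assume p: "p < length a"
    have "card {x \<in> set a. x < a ! p} = card {q. q < length a \<and> a ! q < a ! p}"
      by (rule cnt[OF assms(1)])
    also have "{q. q < length a \<and> a ! q < a ! p} = {q. q < length b \<and> b ! q < b ! p}"
      using less p len by auto
    also have "card \<dots> = card {x \<in> set a. x < b ! p}"
      unfolding assms(4) by (rule cnt[OF assms(2), symmetric])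
    finally have "card {x \<in> set a. x < a ! p} = card {x \<in> set a. x < b ! p}" .
    moreover have "a ! p \<in> set a" "b ! p \<in> set a" using nth_mem[OF p] nth_mem[of p b] p unfolding len assms(4) by blast+
    ultimately show "a ! p = b ! p"
      using mono[of "set a" "a ! p" "b ! p"] mono[of "set a" "b ! p" "a ! p"]
      by (cases "a ! p" "b ! p" rule: linorder_cases) auto
  qed
qed

section \<open>Insertion of a block and its adjoint\<close>

text \<open>The permutation \<open>B n m i \<sigma> \<tau>\<close> carries the pattern \<open>\<tau>\<close> on the positions in
  \<open>block\<close>.  Contracting the block to the single position \<open>i\<close> (\<open>slot\<close>) gives the
  positions of \<open>\<sigma>\<close>, and \<open>pos\<close> is the inverse of the contraction away from the block.\<close>
locale insertion =
  fixes n m i :: nat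
  assumes i: "1 \<le> i" "i \<le> n" and m: "1 \<le> m"
begin

abbreviation "N \<equiv> n + m - 1"
abbreviation "block \<equiv> {i..<i + m}"

definition slot :: "nat \<Rightarrow> nat" where
  "slot P = (if P < i then P else if P < i + m then i else P + 1 - m)"

definition pos :: "nat \<Rightarrow> nat" where
  "pos p = (if p < i then p else p + m - 1)"

lemma slot_pos [simp]: "p \<noteq> i \<Longrightarrow> slot (pos p) = p"
  using m by (auto simp: slot_def pos_def)

lemma pos_slot: "P \<notin> block \<Longrightarrow> pos (slot P) = P"
  using m by (auto simp: slot_def pos_def)

lemma slot_block: "P \<in> block \<Longrightarrow> slot P = i"
  by (auto simp: slot_def)

lemma slot_neq: "P \<notin> block \<Longrightarrow> slot P \<noteq> i"
  using m by (auto simp: slot_def)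

lemma slot_in: "P \<in> {1..N} \<Longrightarrow> slot P \<in> {1..n}"
  using i m by (auto simp: slot_def)

lemma slot_less: "P < Q \<Longrightarrow> \<not> (P \<in> block \<and> Q \<in> block) \<Longrightarrow> slot P < slot Q"
  using i m by (auto simp: slot_def)

lemma pos_in: "p \<in> {1..n} \<Longrightarrow> pos p \<in> {1..N}"
  using m by (auto simp: pos_def)

lemma pos_less: "p < q \<Longrightarrow> pos p < pos q"
  using m by (auto simp: pos_def)

lemma pos_notin: "p \<noteq> i \<Longrightarrow> pos p \<notin> block"
  using m by (auto simp: pos_def)

lemma block_in: "P \<in> block \<Longrightarrow> P \<in> {1..N}"
  using i m by auto

lemma B_block: "P \<in> block \<Longrightarrow> B n m i \<sigma> \<tau> P = \<tau> (P + 1 - i) + \<sigma> i - 1"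
  by (auto simp: B_def Let_def)

lemma B_off_block:
  "P \<in> {1..N} \<Longrightarrow> P \<notin> block \<Longrightarrow>
   B n m i \<sigma> \<tau> P = (if \<sigma> (slot P) < \<sigma> i then \<sigma> (slot P) else \<sigma> (slot P) + m - 1)"
  using i m by (auto simp: B_def Let_def slot_def)

context
  fixes \<sigma> \<tau> :: "nat \<Rightarrow> nat"
  assumes \<sigma>: "\<sigma> \<in> Sym n" and \<tau>: "\<tau> \<in> Sym m"
begin

lemma \<tau>_range: "P \<in> block \<Longrightarrow> 1 \<le> \<tau> (P + 1 - i) \<and> \<tau> (P + 1 - i) \<le> m"
proof -
  assume "P \<in> block"
  then have "P + 1 - i \<in> {1..m}" by auto
  then show ?thesis using Sym_in[OF \<tau>] by (metis atLeastAtMost_iff)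
qed

lemma \<sigma>_range: "p \<in> {1..n} \<Longrightarrow> 1 \<le> \<sigma> p \<and> \<sigma> p \<le> n"
  using Sym_in[OF \<sigma>, of p] by auto

lemma B_less_iff:
  assumes P: "P \<in> {1..N}" and Q: "Q \<in> {1..N}"
  shows "B n m i \<sigma> \<tau> P < B n m i \<sigma> \<tau> Q \<longleftrightarrow>
    (if P \<in> block \<and> Q \<in> block then \<tau> (P + 1 - i) < \<tau> (Q + 1 - i) else \<sigma> (slot P) < \<sigma> (slot Q))"
proof -
  have ne: "R \<notin> block \<Longrightarrow> \<sigma> (slot R) \<noteq> \<sigma> i" for R
    using slot_neq Sym_inj[OF \<sigma>] by simp
  have s: "1 \<le> \<sigma> i" using \<sigma>_range[of i] i by simp
  consider "P \<in> block" "Q \<in> block" | "P \<in> block" "Q \<notin> block" | "P \<notin> block" "Q \<in> block"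
    | "P \<notin> block" "Q \<notin> block" by blast
  then show ?thesis
  proof cases
    case 1
    then show ?thesis using s \<tau>_range[of P] \<tau>_range[of Q] by (simp add: B_block) linarith
  next
    case 2
    then show ?thesis using s ne[of Q] \<tau>_range[of P] Q
      by (simp add: B_block B_off_block slot_block del: atLeastLessThan_iff) linarith
  next
    case 3
    then show ?thesis using s ne[of P] \<tau>_range[of Q] P
      by (simp add: B_block B_off_block slot_block del: atLeastLessThan_iff) linarith
  next
    case 4
    then show ?thesis using m ne[of P] ne[of Q] P Q
      by (auto simp add: B_off_block simp del: atLeastLessThan_iff)
  qed
qed

lemma B_Sym: "B n m i \<sigma> \<tau> \<in> Sym N"
proof (rule Sym_I)
  fix P assume P: "P \<in> {1..N}"
  show "B n m i \<sigma> \<tau> P \<in> {1..N}"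
    using P \<tau>_range[of P] \<sigma>_range[of i] \<sigma>_range[of "slot P"] slot_in[OF P] m i
    by (cases "P \<in> block") (auto simp: B_block B_off_block simp del: atLeastLessThan_iff)
next
  show "inj_on (B n m i \<sigma> \<tau>) {1..N}"
  proof (rule linorder_inj_onI)
    fix P Q assume *: "P < Q" "P \<in> {1..N}" "Q \<in> {1..N}"
    have "P + 1 - i \<noteq> Q + 1 - i" if "P \<in> block" using * that by auto
    then have "B n m i \<sigma> \<tau> P < B n m i \<sigma> \<tau> Q \<or> B n m i \<sigma> \<tau> Q < B n m i \<sigma> \<tau> P"
      unfolding B_less_iff[OF *(2,3)] B_less_iff[OF *(3,2)]
      using Sym_inj[OF \<tau>, of "P + 1 - i" "Q + 1 - i"] slot_less[OF *(1)] Sym_inj[OF \<sigma>, of "slot P" "slot Q"]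
      by (auto simp: not_less_iff_gr_or_eq simp del: atLeastLessThan_iff)
    then show "B n m i \<sigma> \<tau> P \<noteq> B n m i \<sigma> \<tau> Q" by auto
  qed auto
qed (use i m in \<open>auto simp: B_def Let_def\<close>)

end

definition lo :: "(nat \<Rightarrow> nat) \<Rightarrow> nat" where "lo \<rho> = Min (\<rho> ` block)"
definition hi :: "(nat \<Rightarrow> nat) \<Rightarrow> nat" where "hi \<rho> = Max (\<rho> ` block)"

text \<open>How position \<open>p\<close> of the contracted permutation compares with \<open>i\<close>: 0 for smaller entries, 1
  for \<open>i\<close> itself, 2 for larger ones.  An entry of \<open>\<rho>\<close> to the left of the block forms an inversion
  with the whole block only if it exceeds the maximum \<open>hi \<rho>\<close>; otherwise it must count as smaller
  than \<open>i\<close>.  An entry to the right must likewise be below the minimum \<open>lo \<rho>\<close> to count as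
  smaller.  This makes as many pairs as possible inverted in the contraction.\<close>
definition side :: "(nat \<Rightarrow> nat) \<Rightarrow> nat \<Rightarrow> nat" where
  "side \<rho> p = (if p = i then 1
     else if p < i \<and> \<rho> (pos p) < hi \<rho> \<or> i < p \<and> \<rho> (pos p) < lo \<rho> then 0 else 2)"

text \<open>The largest \<open>\<sigma>\<close> with \<open>B n m i \<sigma> \<tau>\<close> below \<open>\<rho>\<close> in the weak order for some
  \<open>\<tau>\<close>.  The key decides a pair of positions by their sides before it looks at \<open>\<rho>\<close>: positions
  \<open>p < i < q\<close> with \<open>p\<close> on side 0 and \<open>q\<close> on side 2 cannot be inverted, even if they are
  inverted in \<open>\<rho>\<close>, as both \<open>p\<close>, \<open>i\<close> and \<open>i\<close>, \<open>q\<close> are in increasing order.\<close>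
definition outer :: "(nat \<Rightarrow> nat) \<Rightarrow> nat \<Rightarrow> nat" where
  "outer \<rho> = rank n (\<lambda>p. (side \<rho> p, \<rho> (pos p)))"

definition inner :: "(nat \<Rightarrow> nat) \<Rightarrow> nat \<Rightarrow> nat" where
  "inner \<rho> = rank m (\<lambda>k. \<rho> (k + i - 1))"

lemma lo_hi: "P \<in> block \<Longrightarrow> lo \<rho> \<le> \<rho> P \<and> \<rho> P \<le> hi \<rho>"
  unfolding lo_def hi_def by simp

lemma lo_hi_attained: "\<exists>P\<in>block. \<rho> P = lo \<rho>" "\<exists>P\<in>block. \<rho> P = hi \<rho>"
proof -
  have "\<rho> ` block \<noteq> {}" using m by auto
  then show "\<exists>P\<in>block. \<rho> P = lo \<rho>" "\<exists>P\<in>block. \<rho> P = hi \<rho>"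
    unfolding lo_def hi_def using Min_in[of "\<rho> ` block"] Max_in[of "\<rho> ` block"] by fastforce+
qed

lemma outer_less_iff:
  "p \<in> {1..n} \<Longrightarrow> q \<in> {1..n} \<Longrightarrow> outer \<rho> p < outer \<rho> q \<longleftrightarrow>
    side \<rho> p < side \<rho> q \<or> side \<rho> p = side \<rho> q \<and> \<rho> (pos p) < \<rho> (pos q)"
  unfolding outer_def by (subst rank_less_iff) (auto simp: less_prod_def)

lemma inner_less_iff:
  "k \<in> {1..m} \<Longrightarrow> l \<in> {1..m} \<Longrightarrow> inner \<rho> k < inner \<rho> l \<longleftrightarrow> \<rho> (k + i - 1) < \<rho> (l + i - 1)"
  unfolding inner_def by (rule rank_less_iff)

context
  fixes \<rho> :: "nat \<Rightarrow> nat"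
  assumes \<rho>: "\<rho> \<in> Sym N"
begin

lemma outer_Sym: "outer \<rho> \<in> Sym n"
  unfolding outer_def
proof (rule rank_Sym, rule inj_onI)
  fix p q assume "(side \<rho> p, \<rho> (pos p)) = (side \<rho> q, \<rho> (pos q))"
  then have "pos p = pos q" by (simp add: Sym_inj[OF \<rho>])
  then show "p = q" using pos_less[of p q] pos_less[of q p] by (cases p q rule: linorder_cases) auto
qed

lemma inner_Sym: "inner \<rho> \<in> Sym m"
  unfolding inner_def using i by (intro rank_Sym inj_onI) (auto simp: Sym_inj[OF \<rho>])

lemma hi_neq: "P \<notin> block \<Longrightarrow> \<rho> P \<noteq> hi \<rho>" and lo_neq: "P \<notin> block \<Longrightarrow> \<rho> P \<noteq> lo \<rho>"
  using lo_hi_attained[of \<rho>] Sym_inj[OF \<rho>] by metis+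

text \<open>An inversion of \<open>B n m i \<sigma> \<tau>\<close> lies inside the block, where it comes from \<open>\<tau>\<close>, or it
  comes from an inversion of \<open>\<sigma>\<close>.  An inversion of \<open>\<sigma>\<close> that involves \<open>i\<close> forces an entire
  block of inversions of \<open>\<rho>\<close>, hence a comparison with \<open>hi \<rho>\<close> or \<open>lo \<rho>\<close>.  An inversion
  \<open>p < i < q\<close> of \<open>\<sigma>\<close> implies that one of the pairs \<open>p\<close>, \<open>i\<close> and \<open>i\<close>, \<open>q\<close> is
  inverted too, which is why the sides are compared first in the definition of \<open>outer\<close>.\<close>
lemma adjunction:
  assumes \<sigma>: "\<sigma> \<in> Sym n" and \<tau>: "\<tau> \<in> Sym m"
  shows "(B n m i \<sigma> \<tau>, \<rho>) \<in> weak_order N \<longleftrightarrow>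
    (\<sigma>, outer \<rho>) \<in> weak_order n \<and> (\<tau>, inner \<rho>) \<in> weak_order m"
proof
  assume le: "(B n m i \<sigma> \<tau>, \<rho>) \<in> weak_order N"
  have inv: "\<rho> Q < \<rho> P" if "P < Q" "P \<in> {1..N}" "Q \<in> {1..N}"
    "if P \<in> block \<and> Q \<in> block then \<tau> (Q + 1 - i) < \<tau> (P + 1 - i) else \<sigma> (slot Q) < \<sigma> (slot P)" for P Q
  proof -
    have "B n m i \<sigma> \<tau> Q < B n m i \<sigma> \<tau> P"
      unfolding B_less_iff[OF \<sigma> \<tau> that(3,2)] using that(4) by (simp only: conj_commute)
    then show ?thesis using le that(1-3) unfolding weak_order_iff by blast
  qed
  have "(\<tau>, inner \<rho>) \<in> weak_order m"
    unfolding weak_order_iff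
  proof (intro conjI \<tau> inner_Sym ballI impI)
    fix k l assume kl: "k \<in> {1..m}" "l \<in> {1..m}" "k < l" "\<tau> l < \<tau> k"
    show "inner \<rho> l < inner \<rho> k"
      unfolding inner_less_iff[OF kl(2,1)] using kl i by (intro inv) auto
  qed
  moreover have "(\<sigma>, outer \<rho>) \<in> weak_order n"
    unfolding weak_order_iff
  proof (intro conjI \<sigma> outer_Sym ballI impI)
    fix p q assume pq: "p \<in> {1..n}" "q \<in> {1..n}" "p < q" "\<sigma> q < \<sigma> p"
    have out: "\<rho> (pos q) < \<rho> (pos p)" if "p \<noteq> i" "q \<noteq> i"
      using pq that by (intro inv pos_less pos_in) (auto simp: pos_notin simp del: atLeastLessThan_iff)
    have R: "hi \<rho> < \<rho> (pos p)" if "p < i" "\<sigma> i < \<sigma> p"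
    proof -
      obtain P where P: "P \<in> block" "\<rho> P = hi \<rho>" using lo_hi_attained by blast
      have "\<rho> P < \<rho> (pos p)"
        using P(1) that pq m i by (intro inv) (auto simp: slot_def pos_def)
      then show ?thesis using P by simp
    qed
    have L: "\<rho> (pos q) < lo \<rho>" if "i < q" "\<sigma> q < \<sigma> i"
    proof -
      obtain P where P: "P \<in> block" "\<rho> P = lo \<rho>" using lo_hi_attained by blast
      have "\<rho> (pos q) < \<rho> P"
        using P(1) that pq m i by (intro inv) (auto simp: slot_def pos_def)
      then show ?thesis using P by simp
    qed
    have LR: "\<sigma> i < \<sigma> p \<or> \<sigma> q < \<sigma> i" using pq(4) by linarith
    have "lo \<rho> \<le> hi \<rho>" using lo_hi[of i \<rho>] m by auto
    then show "outer \<rho> q < outer \<rho> p"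
      unfolding outer_less_iff[OF pq(2,1)] using out R L LR pq(3,4)
      by (auto simp: side_def)
  qed
  ultimately show "(\<sigma>, outer \<rho>) \<in> weak_order n \<and> (\<tau>, inner \<rho>) \<in> weak_order m" by blast
next
  assume le: "(\<sigma>, outer \<rho>) \<in> weak_order n \<and> (\<tau>, inner \<rho>) \<in> weak_order m"
  show "(B n m i \<sigma> \<tau>, \<rho>) \<in> weak_order N"
    unfolding weak_order_iff
  proof (intro conjI B_Sym \<sigma> \<tau> \<rho> ballI impI)
    fix P Q assume PQ: "P \<in> {1..N}" "Q \<in> {1..N}" "P < Q" "B n m i \<sigma> \<tau> Q < B n m i \<sigma> \<tau> P"
    show "\<rho> Q < \<rho> P"
    proof (cases "P \<in> block \<and> Q \<in> block")
      case True
      then have "\<tau> (Q + 1 - i) < \<tau> (P + 1 - i)"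
        using PQ by (simp add: B_less_iff[OF \<sigma> \<tau>] del: atLeastLessThan_iff)
      moreover have k: "P + 1 - i \<in> {1..m}" "Q + 1 - i \<in> {1..m}" "P + 1 - i < Q + 1 - i"
        using True PQ by auto
      ultimately have "inner \<rho> (Q + 1 - i) < inner \<rho> (P + 1 - i)"
        using le unfolding weak_order_iff by blast
      then show ?thesis using True unfolding inner_less_iff[OF k(2,1)] by simp
    next
      case False
      then have "\<sigma> (slot Q) < \<sigma> (slot P)"
        using PQ by (auto simp: B_less_iff[OF \<sigma> \<tau>] simp del: atLeastLessThan_iff)
      then have "outer \<rho> (slot Q) < outer \<rho> (slot P)"
        using le slot_less[OF PQ(3) False] slot_in PQ unfolding weak_order_iff by blast
      then have *: "side \<rho> (slot Q) < side \<rho> (slot P) \<or>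
          side \<rho> (slot P) = side \<rho> (slot Q) \<and> \<rho> (pos (slot Q)) < \<rho> (pos (slot P))"
        using outer_less_iff[OF slot_in[OF PQ(2)] slot_in[OF PQ(1)]] by auto
      have io: "lo \<rho> \<le> hi \<rho>" using lo_hi[of i \<rho>] m by auto
      consider "P \<notin> block" "Q \<notin> block" | "P \<in> block" "Q \<notin> block" | "P \<notin> block" "Q \<in> block"
        using False by blast
      then show ?thesis
      proof cases
        case 1
        then show ?thesis
          using * io slot_neq[of P] slot_neq[of Q] slot_less[OF PQ(3) False]
          by (auto simp: pos_slot side_def simp del: atLeastLessThan_iff split: if_splits)
      next
        case 2
        then have "\<not> slot Q < i" using slot_less[OF PQ(3) False] slot_block by auto
        then show ?thesis using * 2 lo_hi[of P \<rho>] slot_neq[of Q]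
          by (auto simp: pos_slot side_def slot_block simp del: atLeastLessThan_iff split: if_splits)
      next
        case 3
        then have "\<not> i < slot P" using slot_less[OF PQ(3) False] slot_block by auto
        then show ?thesis using * 3 lo_hi[of Q \<rho>] slot_neq[of P] hi_neq[of P]
          by (auto simp: pos_slot side_def slot_block simp del: atLeastLessThan_iff split: if_splits)
      qed
    qed
  qed
qed

end


section \<open>Fibres of the adjoint are intervals\<close>

text \<open>Position \<open>p\<close> belongs to the run of consecutive values just below \<open>\<sigma> i\<close> that all occur to the
  left of \<open>i\<close>; \<open>above_run\<close> is the mirror image, with values just above \<open>\<sigma> i\<close> that occur to
  the right of \<open>i\<close>.\<close>
definition below_run :: "(nat \<Rightarrow> nat) \<Rightarrow> nat \<Rightarrow> bool" where
  "below_run \<sigma> p \<longleftrightarrow> p < i \<and> \<sigma> p < \<sigma> i \<and> (\<forall>x\<in>{1..n}. \<sigma> p < \<sigma> x \<and> \<sigma> x < \<sigma> i \<longrightarrow> x < i)"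

definition above_run :: "(nat \<Rightarrow> nat) \<Rightarrow> nat \<Rightarrow> bool" where
  "above_run \<sigma> q \<longleftrightarrow> i < q \<and> \<sigma> i < \<sigma> q \<and> (\<forall>x\<in>{1..n}. \<sigma> i < \<sigma> x \<and> \<sigma> x < \<sigma> q \<longrightarrow> i < x)"

text \<open>The pairs \<open>P < Q\<close> that are inverted in \<open>T n m i \<sigma> \<tau>\<close> but not in \<open>B n m i \<sigma> \<tau>\<close>.
  Entries of the lower run may pass every block entry but the largest, for then \<open>outer\<close> still
  counts them as smaller than \<open>i\<close>; entries of the upper run may pass every block entry but the
  smallest.  Two entries, one from each run, may then also pass each other, provided that the
  smallest and the largest block entry are different.\<close>
definition extra_inv :: "(nat \<Rightarrow> nat) \<Rightarrow> (nat \<Rightarrow> nat) \<Rightarrow> nat \<Rightarrow> nat \<Rightarrow> bool" where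
  "extra_inv \<sigma> \<tau> P Q \<longleftrightarrow>
    below_run \<sigma> (slot P) \<and> Q \<in> block \<and> \<tau> (Q + 1 - i) \<noteq> m \<or>
    P \<in> block \<and> \<tau> (P + 1 - i) \<noteq> 1 \<and> above_run \<sigma> (slot Q) \<or>
    1 < m \<and> below_run \<sigma> (slot P) \<and> above_run \<sigma> (slot Q)"

text \<open>The key step: the permutations with given \<open>outer\<close> and \<open>inner\<close> form an interval, whose
  upper end has the inversions described by \<open>extra_inv\<close>.

  If \<open>\<rho>\<close> lies between the bounds, no position to the left with \<open>\<sigma>\<close> value below \<open>\<sigma> i\<close>
  has a \<open>\<rho>\<close> entry above the largest block entry, and symmetrically on the right, so
  the sides of all positions can be read off \<open>\<sigma>\<close>, and \<open>outer \<rho>\<close> has no more inversions than \<open>\<sigma>\<close>.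

  Conversely, let \<open>\<sigma> = outer \<rho>\<close>.  If the \<open>\<rho>\<close> entry of a position \<open>p\<close> left of the
  block is below \<open>hi \<rho>\<close> but not below \<open>lo \<rho>\<close>, then \<open>p\<close> lies
  in the lower run: a position \<open>x > i\<close> with value between \<open>\<sigma> p\<close> and \<open>\<sigma> i\<close> would have
  a \<open>\<rho>\<close> entry below \<open>lo \<rho>\<close>, so the pair
  \<open>p\<close>, \<open>x\<close> would be inverted in \<open>\<sigma>\<close>.  Hence the additional inversions of \<open>\<rho>\<close> are all
  among the permitted ones.\<close>
lemma interval_iff:
  assumes \<sigma>: "\<sigma> \<in> Sym n" and \<tau>: "\<tau> \<in> Sym m" and \<rho>: "\<rho> \<in> Sym N" and U: "U \<in> Sym N"
    and U_less: "\<And>P Q. P \<in> {1..N} \<Longrightarrow> Q \<in> {1..N} \<Longrightarrow> P < Q \<Longrightarrow>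
      U Q < U P \<longleftrightarrow> B n m i \<sigma> \<tau> Q < B n m i \<sigma> \<tau> P \<or> extra_inv \<sigma> \<tau> P Q"
  shows "(B n m i \<sigma> \<tau>, \<rho>) \<in> weak_order N \<and> (\<rho>, U) \<in> weak_order N \<longleftrightarrow>
    \<sigma> = outer \<rho> \<and> \<tau> = inner \<rho>"
proof
  assume le: "(B n m i \<sigma> \<tau>, \<rho>) \<in> weak_order N \<and> (\<rho>, U) \<in> weak_order N"
  have inv: "(if P \<in> block \<and> Q \<in> block then \<tau> (Q + 1 - i) < \<tau> (P + 1 - i) else \<sigma> (slot Q) < \<sigma> (slot P))
      \<or> extra_inv \<sigma> \<tau> P Q" if "P < Q" "P \<in> {1..N}" "Q \<in> {1..N}" "\<rho> Q < \<rho> P" for P Q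
  proof -
    have "U Q < U P" using le that unfolding weak_order_iff by blast
    then show ?thesis
      unfolding U_less[OF that(2,3,1)] B_less_iff[OF \<sigma> \<tau> that(3,2)] by (simp only: conj_commute)
  qed
  have run_neq: "\<not> below_run \<sigma> i" "\<not> above_run \<sigma> i" by (simp_all add: below_run_def above_run_def)
  have "(inner \<rho>, \<tau>) \<in> weak_order m"
    unfolding weak_order_iff
  proof (intro conjI \<tau> inner_Sym \<rho> ballI impI)
    fix k l assume kl: "k \<in> {1..m}" "l \<in> {1..m}" "k < l" "inner \<rho> l < inner \<rho> k"
    define P Q where "P = k + i - 1" and "Q = l + i - 1"
    have PQ: "P \<in> block" "Q \<in> block" "P < Q" "P + 1 - i = k" "Q + 1 - i = l"
      using kl i by (auto simp: P_def Q_def)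
    have "\<rho> Q < \<rho> P" using kl(4) unfolding inner_less_iff[OF kl(2,1)] by (simp add: P_def Q_def)
    then have "\<tau> l < \<tau> k \<or> extra_inv \<sigma> \<tau> P Q"
      using inv[OF PQ(3) block_in block_in] PQ by simp
    then show "\<tau> l < \<tau> k"
      using run_neq PQ(1,2) by (auto simp: extra_inv_def slot_block simp del: atLeastLessThan_iff)
  qed
  moreover have "(outer \<rho>, \<sigma>) \<in> weak_order n"
    unfolding weak_order_iff
  proof (intro conjI \<sigma> outer_Sym \<rho> ballI impI, rule ccontr)
    fix p q assume pq: "p \<in> {1..n}" "q \<in> {1..n}" "p < q" "outer \<rho> q < outer \<rho> p" "\<not> \<sigma> q < \<sigma> p"
    have lt: "\<sigma> p < \<sigma> q" using pq Sym_inj[OF \<sigma>, of p q] by auto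
    have side: "side \<rho> q < side \<rho> p \<or> side \<rho> p = side \<rho> q \<and> \<rho> (pos q) < \<rho> (pos p)"
      using pq(4) outer_less_iff[OF pq(2,1)] by auto
    have L: "\<rho> (pos p) < hi \<rho>" if "p < i" "\<sigma> p < \<sigma> i"
    proof -
      obtain k where k: "k \<in> {1..m}" "\<tau> k = m" using Sym_surj[OF \<tau>, of m] m by auto
      define Q where "Q = k + i - 1"
      have Q: "Q \<in> block" "Q + 1 - i = k" "pos p < Q" "pos p \<notin> block" "slot (pos p) = p"
        using k i that by (auto simp: Q_def pos_def slot_def)
      have "\<not> \<rho> Q < \<rho> (pos p)"
      proof
        assume "\<rho> Q < \<rho> (pos p)"
        then have "\<sigma> i < \<sigma> p \<or> extra_inv \<sigma> \<tau> (pos p) Q"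
          using inv[OF Q(3) pos_in[OF pq(1)] block_in[OF Q(1)]] Q
          by (simp add: slot_block del: atLeastLessThan_iff)
        then show False using that Q k run_neq
          by (auto simp: extra_inv_def slot_block simp del: atLeastLessThan_iff)
      qed
      then show ?thesis using lo_hi[OF Q(1), of \<rho>] hi_neq[OF \<rho> Q(4)] by simp
    qed
    have R: "lo \<rho> < \<rho> (pos q)" if "i < q" "\<sigma> i < \<sigma> q"
    proof -
      obtain k where k: "k \<in> {1..m}" "\<tau> k = 1" using Sym_surj[OF \<tau>, of 1] m by auto
      define P where "P = k + i - 1"
      have P: "P \<in> block" "P + 1 - i = k" "P < pos q" "pos q \<notin> block" "slot (pos q) = q"
        using k i m that by (auto simp: P_def pos_def slot_def)
      have "\<not> \<rho> (pos q) < \<rho> P"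
      proof
        assume "\<rho> (pos q) < \<rho> P"
        then have "\<sigma> q < \<sigma> i \<or> extra_inv \<sigma> \<tau> P (pos q)"
          using inv[OF P(3) block_in[OF P(1)] pos_in[OF pq(2)]] P
          by (simp add: slot_block del: atLeastLessThan_iff)
        then show False using that P k run_neq
          by (auto simp: extra_inv_def slot_block simp del: atLeastLessThan_iff)
      qed
      then show ?thesis using lo_hi[OF P(1), of \<rho>] lo_neq[OF \<rho> P(4)] by simp
    qed
    consider "p = i" | "q = i" | "p \<noteq> i" "q \<noteq> i" by blast
    then show False
    proof cases
      case 1
      then show False using R lt pq(3) side by (auto simp: side_def split: if_splits)
    next
      case 2
      then show False using L lt pq(3) side by (auto simp: side_def split: if_splits)
    next
      case 3
      have lohi: "lo \<rho> \<le> hi \<rho>" using lo_hi[of i \<rho>] m by auto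
      have "extra_inv \<sigma> \<tau> (pos p) (pos q)" if "\<rho> (pos q) < \<rho> (pos p)"
        using inv[OF pos_less[OF pq(3)] pos_in[OF pq(1)] pos_in[OF pq(2)] that] 3 lt
        by (simp add: pos_notin del: atLeastLessThan_iff)
      then have runs: "below_run \<sigma> p \<and> above_run \<sigma> q" if "\<rho> (pos q) < \<rho> (pos p)"
        using that 3 unfolding extra_inv_def by (simp add: pos_notin del: atLeastLessThan_iff)
      have "side \<rho> q < side \<rho> p \<Longrightarrow> \<rho> (pos q) < \<rho> (pos p)"
        using 3 pq(3) lohi by (auto simp: side_def split: if_splits)
      then have "\<rho> (pos q) < \<rho> (pos p)" using side by blast
      with runs have "p < i" "\<sigma> p < \<sigma> i" "i < q" "\<sigma> i < \<sigma> q"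
        unfolding below_run_def above_run_def by blast+
      then show False using L R side by (auto simp: side_def)
    qed
  qed
  ultimately show "\<sigma> = outer \<rho> \<and> \<tau> = inner \<rho>"
    using le adjunction[OF \<rho> \<sigma> \<tau>] weak_order_antisym by blast
next
  assume eq: "\<sigma> = outer \<rho> \<and> \<tau> = inner \<rho>"
  have "(B n m i \<sigma> \<tau>, \<rho>) \<in> weak_order N"
    using adjunction[OF \<rho> \<sigma> \<tau>] eq \<sigma> \<tau> by (simp add: weak_order_iff)
  moreover have "(\<rho>, U) \<in> weak_order N"
    unfolding weak_order_iff
  proof (intro conjI \<rho> U ballI impI, rule ccontr)
    fix P Q assume PQ: "P \<in> {1..N}" "Q \<in> {1..N}" "P < Q" "\<rho> Q < \<rho> P" "\<not> U Q < U P"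
    have nB: "\<not> B n m i \<sigma> \<tau> Q < B n m i \<sigma> \<tau> P" and nE: "\<not> extra_inv \<sigma> \<tau> P Q"
      using U_less[OF PQ(1-3)] PQ(5) by auto
    have \<sigma>_less: "\<sigma> p < \<sigma> q \<longleftrightarrow> side \<rho> p < side \<rho> q \<or> side \<rho> p = side \<rho> q \<and> \<rho> (pos p) < \<rho> (pos q)"
      if "p \<in> {1..n}" "q \<in> {1..n}" for p q
      using outer_less_iff[OF that] eq by simp
    have \<tau>_less: "\<tau> (P + 1 - i) < \<tau> (Q + 1 - i) \<longleftrightarrow> \<rho> P < \<rho> Q" if "P \<in> block" "Q \<in> block" for P Q
    proof -
      have "P + 1 - i \<in> {1..m}" "Q + 1 - i \<in> {1..m}" using that by auto
      then show ?thesis using inner_less_iff[of "P + 1 - i" "Q + 1 - i" \<rho>] eq that by simp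
    qed
    have i_in: "i \<in> {1..n}" using i by simp
    have lohi: "lo \<rho> \<le> hi \<rho>" using lo_hi[of i \<rho>] m by auto
    have below: "below_run \<sigma> p" if p: "p \<in> {1..n}" "p < i" "\<rho> (pos p) < hi \<rho>" "lo \<rho> \<le> \<rho> (pos p)" for p
      unfolding below_run_def
    proof (intro conjI ballI impI that)
      show "\<sigma> p < \<sigma> i" unfolding \<sigma>_less[OF p(1) i_in] using p by (simp add: side_def)
      fix x assume x: "x \<in> {1..n}" "\<sigma> p < \<sigma> x \<and> \<sigma> x < \<sigma> i"
      then show "x < i"
        unfolding \<sigma>_less[OF p(1) x(1)] \<sigma>_less[OF x(1) i_in] using p
        by (auto simp: side_def split: if_splits)
    qed
    have above: "above_run \<sigma> q" if q: "q \<in> {1..n}" "i < q" "lo \<rho> < \<rho> (pos q)" "\<rho> (pos q) \<le> hi \<rho>" for q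
      unfolding above_run_def
    proof (intro conjI ballI impI that)
      show "\<sigma> i < \<sigma> q" unfolding \<sigma>_less[OF i_in q(1)] using q by (simp add: side_def)
      fix x assume x: "x \<in> {1..n}" "\<sigma> i < \<sigma> x \<and> \<sigma> x < \<sigma> q"
      then show "i < x"
        unfolding \<sigma>_less[OF x(1) q(1)] \<sigma>_less[OF i_in x(1)] using q
        by (auto simp: side_def split: if_splits)
    qed
    consider "P \<in> block" "Q \<in> block" | "P \<notin> block" "Q \<in> block" | "P \<in> block" "Q \<notin> block"
      | "P \<notin> block" "Q \<notin> block" by blast
    then show False
    proof cases
      case 1
      then show False using nB \<tau>_less[of Q P] PQ B_less_iff[OF \<sigma> \<tau> PQ(2,1)]
        by (simp del: atLeastLessThan_iff)
    next
      case 2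
      have Pi: "slot P < i" using slot_less[OF PQ(3)] 2 slot_block by auto
      have "\<not> \<sigma> i < \<sigma> (slot P)"
        using nB 2 unfolding B_less_iff[OF \<sigma> \<tau> PQ(2,1)] by (simp add: slot_block del: atLeastLessThan_iff)
      then have "\<rho> P < hi \<rho>"
        unfolding \<sigma>_less[OF i_in slot_in[OF PQ(1)]] using Pi 2
        by (auto simp: side_def pos_slot simp del: atLeastLessThan_iff split: if_splits)
      then have "below_run \<sigma> (slot P)"
        using below[OF slot_in[OF PQ(1)] Pi] lo_hi[OF 2(2), of \<rho>] PQ(4)
        by (simp add: pos_slot[OF 2(1)])
      moreover have "\<tau> (Q + 1 - i) \<noteq> m"
      proof -
        obtain R where R: "R \<in> block" "\<rho> R = hi \<rho>" using lo_hi_attained by blast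
        have "\<rho> Q < \<rho> R" using R PQ(4) \<open>\<rho> P < hi \<rho>\<close> by simp
        then have "\<tau> (Q + 1 - i) < \<tau> (R + 1 - i)" using \<tau>_less[OF 2(2) R(1)] by simp
        then show ?thesis using \<tau>_range[OF \<sigma> \<tau> R(1)] by simp
      qed
      ultimately show False using nE 2(2) by (auto simp: extra_inv_def)
    next
      case 3
      have Qi: "i < slot Q" using slot_less[OF PQ(3)] 3 slot_block by auto
      have "\<not> \<sigma> (slot Q) < \<sigma> i"
        using nB 3 unfolding B_less_iff[OF \<sigma> \<tau> PQ(2,1)] by (simp add: slot_block del: atLeastLessThan_iff)
      then have "lo \<rho> < \<rho> Q"
        unfolding \<sigma>_less[OF slot_in[OF PQ(2)] i_in] using Qi 3 lo_neq[OF \<rho> 3(2)]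
        by (auto simp: side_def pos_slot simp del: atLeastLessThan_iff split: if_splits)
      then have "above_run \<sigma> (slot Q)"
        using above[OF slot_in[OF PQ(2)] Qi] lo_hi[OF 3(1), of \<rho>] PQ(4)
        by (simp add: pos_slot[OF 3(2)])
      moreover have "\<tau> (P + 1 - i) \<noteq> 1"
      proof -
        obtain R where R: "R \<in> block" "\<rho> R = lo \<rho>" using lo_hi_attained by blast
        have "\<rho> R < \<rho> P" using R PQ(4) \<open>lo \<rho> < \<rho> Q\<close> by simp
        then have "\<tau> (R + 1 - i) < \<tau> (P + 1 - i)" using \<tau>_less[OF R(1) 3(1)] by simp
        then show ?thesis using \<tau>_range[OF \<sigma> \<tau> R(1)] by simp
      qed
      ultimately show False using nE 3(1) by (auto simp: extra_inv_def)
    next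
      case 4
      have sl: "slot P < slot Q" using slot_less[OF PQ(3)] 4 by blast
      have "\<not> \<sigma> (slot Q) < \<sigma> (slot P)"
        using nB 4 unfolding B_less_iff[OF \<sigma> \<tau> PQ(2,1)] by (simp del: atLeastLessThan_iff)
      then have "side \<rho> (slot P) < side \<rho> (slot Q)"
        using PQ(4) unfolding \<sigma>_less[OF slot_in[OF PQ(2)] slot_in[OF PQ(1)]]
          pos_slot[OF 4(1)] pos_slot[OF 4(2)] by linarith
      then have "slot P < i \<and> \<rho> P < hi \<rho> \<or> i < slot P \<and> \<rho> P < lo \<rho>"
          "\<not> (slot Q < i \<and> \<rho> Q < hi \<rho> \<or> i < slot Q \<and> \<rho> Q < lo \<rho>)"
        using slot_neq[OF 4(1)] slot_neq[OF 4(2)]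
        unfolding side_def pos_slot[OF 4(1)] pos_slot[OF 4(2)] by (simp_all split: if_splits)
      then have *: "slot P < i \<and> i < slot Q \<and> \<rho> P < hi \<rho> \<and> lo \<rho> < \<rho> Q"
        using slot_neq[OF 4(2)] sl lohi lo_neq[OF \<rho> 4(2)] PQ(4) by linarith
      moreover have "1 < m"
      proof (rule ccontr)
        assume "\<not> 1 < m"
        then have "block = {i}" using m by auto
        then have "lo \<rho> = hi \<rho>" by (simp add: lo_def hi_def)
        then show False using * PQ(4) by simp
      qed
      moreover have "below_run \<sigma> (slot P)" "above_run \<sigma> (slot Q)"
        using below[OF slot_in[OF PQ(1)]] above[OF slot_in[OF PQ(2)]] * PQ(4)
        by (simp_all add: pos_slot 4 del: atLeastLessThan_iff)
      ultimately show False using nE by (auto simp: extra_inv_def)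
    qed
  qed
  ultimately show "(B n m i \<sigma> \<tau>, \<rho>) \<in> weak_order N \<and> (\<rho>, U) \<in> weak_order N" by blast
qed


lemma set_seq: "set (seq1 n m i \<rho>) = (\<lambda>P. int (\<rho> P)) ` {1..<i}"
  "set (seq2 n m i \<rho>) = (\<lambda>P. int (\<rho> P)) ` block"
  "set (seq3 n m i \<rho>) = (\<lambda>P. int (\<rho> P)) ` {i + m..<n + m}"
  unfolding seq1_def seq2_def seq3_def set_map set_upt by (rule refl)+

lemma eq_if_seq_eq:
  assumes \<pi>: "\<pi> \<in> Sym N" and \<rho>: "\<rho> \<in> Sym N"
    and st: "st (seq1 n m i \<pi>) = st (seq1 n m i \<rho>)" "st (seq2 n m i \<pi>) = st (seq2 n m i \<rho>)"
      "st (seq3 n m i \<pi>) = st (seq3 n m i \<rho>)"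
    and set: "set (seq1 n m i \<pi>) = set (seq1 n m i \<rho>)" "set (seq2 n m i \<pi>) = set (seq2 n m i \<rho>)"
      "set (seq3 n m i \<pi>) = set (seq3 n m i \<rho>)"
  shows "\<pi> = \<rho>"
proof (rule Sym_eq_of_same_order[OF \<pi> \<rho>])
  have dist: "distinct (seq1 n m i \<chi>)" "distinct (seq2 n m i \<chi>)" "distinct (seq3 n m i \<chi>)"
    if "\<chi> \<in> Sym N" for \<chi>
    using Sym_inj[OF that] by (auto simp: seq1_def seq2_def seq3_def distinct_map inj_on_def)
  have "seq1 n m i \<pi> = seq1 n m i \<rho>" "seq2 n m i \<pi> = seq2 n m i \<rho>" "seq3 n m i \<pi> = seq3 n m i \<rho>"
    by (intro eq_if_st_set_eq dist \<pi> \<rho> st set)+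
  then have agree: "\<pi> P = \<rho> P" if "P \<in> {1..<i} \<union> block \<union> {i + m..<n + m}" for P
    using that unfolding seq1_def seq2_def seq3_def by auto
  fix P Q assume "P \<in> {1..N}" "Q \<in> {1..N}"
  then have "\<pi> P = \<rho> P" "\<pi> Q = \<rho> Q" by (auto intro!: agree)
  then show "\<pi> P < \<pi> Q \<longleftrightarrow> \<rho> P < \<rho> Q" by simp
qed

end

locale insertion_pair = insertion +
  fixes \<sigma> \<tau> :: "nat \<Rightarrow> nat"
  assumes \<sigma>: "\<sigma> \<in> Sym n" and \<tau>: "\<tau> \<in> Sym m"
begin

section \<open>An explicit form of the upper bound\<close>

text \<open>The lengths of the two runs, called \<open>k\<close> and \<open>l\<close> with index \<open>\<sigma>\<close> in the definition of
  the upper bound.\<close>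
definition depth :: nat where
  "depth = Max {j \<in> {0..i - 1}. {int (\<sigma> i) - int j..int (\<sigma> i)} \<subseteq> set (seq1 n m i (B n m i \<sigma> \<tau>)) \<union> {int (\<sigma> i)}}"

definition height :: nat where
  "height = Max {j \<in> {0..n - i}. {int (\<sigma> i) + int m - 1..int (\<sigma> i) + int m - 1 + int j}
     \<subseteq> {int (\<sigma> i) + int m - 1} \<union> set (seq3 n m i (B n m i \<sigma> \<tau>))}"

lemma B_left: "P \<in> {1..<i} \<Longrightarrow> B n m i \<sigma> \<tau> P = (if \<sigma> P < \<sigma> i then \<sigma> P else \<sigma> P + m - 1)"
  using i by (subst B_off_block) (auto simp: slot_def)

lemma B_right: "q \<in> {i<..n} \<Longrightarrow> B n m i \<sigma> \<tau> (q + m - 1) = (if \<sigma> q < \<sigma> i then \<sigma> q else \<sigma> q + m - 1)"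
  using i m by (subst B_off_block) (auto simp: slot_def)

text \<open>Counting gives the bound \<open>j \<le> i - 1\<close> in the maximum: a run of \<open>j\<close> values needs
  as many positions to the left of \<open>i\<close>.\<close>
lemma depth_iff:
  "j \<le> depth \<longleftrightarrow> j < \<sigma> i \<and> {\<sigma> i - j..<\<sigma> i} \<subseteq> \<sigma> ` {1..<i}"
proof -
  let ?P = "\<lambda>j. {int (\<sigma> i) - int j..int (\<sigma> i)} \<subseteq> set (seq1 n m i (B n m i \<sigma> \<tau>)) \<union> {int (\<sigma> i)}"
  have vals: "int v \<in> set (seq1 n m i (B n m i \<sigma> \<tau>)) \<longleftrightarrow> v \<in> \<sigma> ` {1..<i}" if "v < \<sigma> i" for v
  proof -
    have "B n m i \<sigma> \<tau> P = v \<longleftrightarrow> \<sigma> P = v" if "P \<in> {1..<i}" for P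
      using \<open>v < \<sigma> i\<close> m B_left[OF that] by auto
    then show ?thesis unfolding set_seq by (force simp: image_iff)
  qed
  have P: "?P j \<longleftrightarrow> j < \<sigma> i \<and> {\<sigma> i - j..<\<sigma> i} \<subseteq> \<sigma> ` {1..<i}" for j
  proof
    assume run: "?P j"
    have "\<not> \<sigma> i \<le> j"
    proof
      assume "\<sigma> i \<le> j"
      then have "int 0 \<in> {int (\<sigma> i) - int j..int (\<sigma> i)}" by simp
      moreover have s: "0 < \<sigma> i" using \<sigma>_range[OF \<sigma> \<tau>, of i] i by simp
      ultimately have "int 0 \<in> set (seq1 n m i (B n m i \<sigma> \<tau>))" using run by fastforce
      then obtain p where "p \<in> {1..<i}" "\<sigma> p = 0" using vals[OF s] by force
      then show False using \<sigma>_range[OF \<sigma> \<tau>, of p] i by simp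
    qed
    moreover have "v \<in> \<sigma> ` {1..<i}" if "v \<in> {\<sigma> i - j..<\<sigma> i}" for v
    proof -
      have "int v \<in> {int (\<sigma> i) - int j..int (\<sigma> i)}" "int v \<noteq> int (\<sigma> i)" using that by auto
      then have "int v \<in> set (seq1 n m i (B n m i \<sigma> \<tau>))" using run by blast
      then show ?thesis using vals that by simp
    qed
    ultimately show "j < \<sigma> i \<and> {\<sigma> i - j..<\<sigma> i} \<subseteq> \<sigma> ` {1..<i}" by (simp add: subset_iff)
  next
    assume run: "j < \<sigma> i \<and> {\<sigma> i - j..<\<sigma> i} \<subseteq> \<sigma> ` {1..<i}"
    show "?P j"
    proof
      fix x assume x: "x \<in> {int (\<sigma> i) - int j..int (\<sigma> i)}"
      then have nn: "x = int (nat x)" using run by simp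
      show "x \<in> set (seq1 n m i (B n m i \<sigma> \<tau>)) \<union> {int (\<sigma> i)}"
      proof (cases "nat x = \<sigma> i")
        case True
        then show ?thesis using nn by simp
      next
        case False
        then have "nat x \<in> {\<sigma> i - j..<\<sigma> i}" using x run by auto
        then have "nat x \<in> \<sigma> ` {1..<i}" "nat x < \<sigma> i" using run by auto
        then have "int (nat x) \<in> set (seq1 n m i (B n m i \<sigma> \<tau>))" using vals by blast
        then show ?thesis using nn by simp
      qed
    qed
  qed
  have "j \<le> depth \<longleftrightarrow> j \<le> i - 1 \<and> ?P j"
    unfolding depth_def
  proof (rule le_Max_iff)
    fix j j' :: nat assume "?P j'" "j \<le> j'"
    moreover from this have "{int (\<sigma> i) - int j..int (\<sigma> i)} \<subseteq> {int (\<sigma> i) - int j'..int (\<sigma> i)}" by auto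
    ultimately show "?P j" by blast
  qed simp
  moreover have "j \<le> i - 1" if "j < \<sigma> i" "{\<sigma> i - j..<\<sigma> i} \<subseteq> \<sigma> ` {1..<i}"
  proof -
    have "card {\<sigma> i - j..<\<sigma> i} \<le> card (\<sigma> ` {1..<i})" using that by (intro card_mono) auto
    also have "\<dots> \<le> card {1..<i}" by (rule card_image_le) simp
    finally show ?thesis using that by simp
  qed
  ultimately show ?thesis unfolding P by blast
qed

lemma height_iff:
  "j \<le> height \<longleftrightarrow> \<sigma> i + j \<le> n \<and> {\<sigma> i<..\<sigma> i + j} \<subseteq> \<sigma> ` {i<..n}"
proof -
  let ?e = "int (\<sigma> i) + int m - 1"
  let ?P = "\<lambda>j. {?e..?e + int j} \<subseteq> {?e} \<union> set (seq3 n m i (B n m i \<sigma> \<tau>))"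
  have set3: "set (seq3 n m i (B n m i \<sigma> \<tau>)) = (\<lambda>q. int (B n m i \<sigma> \<tau> (q + m - 1))) ` {i<..n}"
  proof -
    have "{i + m..<n + m} = (\<lambda>q. q + m - 1) ` {i<..n}"
    proof (intro equalityI subsetI)
      fix P assume "P \<in> {i + m..<n + m}"
      then show "P \<in> (\<lambda>q. q + m - 1) ` {i<..n}"
        using m by (intro image_eqI[of _ _ "P + 1 - m"]) auto
    qed (use m in auto)
    then show ?thesis unfolding set_seq by (simp add: image_image)
  qed
  have vals: "int v + int m - 1 \<in> set (seq3 n m i (B n m i \<sigma> \<tau>)) \<longleftrightarrow> v \<in> \<sigma> ` {i<..n}"
    if "\<sigma> i < v" for v
  proof -
    have "int v + int m - 1 = int (B n m i \<sigma> \<tau> (q + m - 1)) \<longleftrightarrow> v = \<sigma> q" if "q \<in> {i<..n}" for q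
      unfolding B_right[OF that] using \<open>\<sigma> i < v\<close> m Sym_inj[OF \<sigma>, of q i] that by auto
    then show ?thesis unfolding set3 by (auto simp: image_iff)
  qed
  have P: "?P j \<longleftrightarrow> \<sigma> i + j \<le> n \<and> {\<sigma> i<..\<sigma> i + j} \<subseteq> \<sigma> ` {i<..n}" for j
  proof
    assume run: "?P j"
    have sub: "v \<in> \<sigma> ` {i<..n}" if "v \<in> {\<sigma> i<..\<sigma> i + j}" for v
    proof -
      have "int v + int m - 1 \<in> {?e..?e + int j}" "int v + int m - 1 \<noteq> ?e" using that by auto
      then have "int v + int m - 1 \<in> set (seq3 n m i (B n m i \<sigma> \<tau>))" using run by blast
      then show ?thesis using vals that by simp
    qed
    moreover have "\<sigma> i + j \<le> n"
    proof (cases "j = 0")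
      case False
      then have "\<sigma> i + j \<in> \<sigma> ` {i<..n}" by (intro sub) simp
      then obtain q where "q \<in> {i<..n}" "\<sigma> i + j = \<sigma> q" by blast
      then show ?thesis using \<sigma>_range[OF \<sigma> \<tau>, of q] by simp
    qed (use \<sigma>_range[OF \<sigma> \<tau>, of i] i in simp)
    ultimately show "\<sigma> i + j \<le> n \<and> {\<sigma> i<..\<sigma> i + j} \<subseteq> \<sigma> ` {i<..n}" by (simp add: subset_iff)
  next
    assume run: "\<sigma> i + j \<le> n \<and> {\<sigma> i<..\<sigma> i + j} \<subseteq> \<sigma> ` {i<..n}"
    show "?P j"
    proof
      fix x assume x: "x \<in> {?e..?e + int j}"
      define v where "v = nat (x + 1 - int m)"
      have v: "x = int v + int m - 1" "\<sigma> i \<le> v" "v \<le> \<sigma> i + j" using x m by (auto simp: v_def)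
      show "x \<in> {?e} \<union> set (seq3 n m i (B n m i \<sigma> \<tau>))"
      proof (cases "v = \<sigma> i")
        case True
        then show ?thesis using v by simp
      next
        case False
        then have "v \<in> {\<sigma> i<..\<sigma> i + j}" "\<sigma> i < v" using v by auto
        then show ?thesis using run vals v(1) by blast
      qed
    qed
  qed
  have "j \<le> height \<longleftrightarrow> j \<le> n - i \<and> ?P j"
    unfolding height_def
  proof (rule le_Max_iff)
    fix j j' :: nat assume "?P j'" "j \<le> j'"
    moreover from this have "{?e..?e + int j} \<subseteq> {?e..?e + int j'}" by auto
    ultimately show "?P j" by blast
  qed simp
  moreover have "j \<le> n - i" if "{\<sigma> i<..\<sigma> i + j} \<subseteq> \<sigma> ` {i<..n}"
  proof -
    have "card {\<sigma> i<..\<sigma> i + j} \<le> card (\<sigma> ` {i<..n})" using that by (intro card_mono) auto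
    also have "\<dots> \<le> card {i<..n}" by (rule card_image_le) simp
    finally show ?thesis by simp
  qed
  ultimately show ?thesis unfolding P by blast
qed

lemma depth_less: "depth < \<sigma> i" and depth_values: "{\<sigma> i - depth..<\<sigma> i} \<subseteq> \<sigma> ` {1..<i}"
  using depth_iff[of depth] by auto

lemma height_le: "\<sigma> i + height \<le> n" and height_values: "{\<sigma> i<..\<sigma> i + height} \<subseteq> \<sigma> ` {i<..n}"
  using height_iff[of height] by auto

lemma below_run_iff:
  assumes "p \<in> {1..n}"
  shows "below_run \<sigma> p \<longleftrightarrow> \<sigma> i - depth \<le> \<sigma> p \<and> \<sigma> p < \<sigma> i"
proof
  assume run: "below_run \<sigma> p"
  have "{\<sigma> i - (\<sigma> i - \<sigma> p)..<\<sigma> i} \<subseteq> \<sigma> ` {1..<i}"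
  proof
    fix v assume v: "v \<in> {\<sigma> i - (\<sigma> i - \<sigma> p)..<\<sigma> i}"
    have "v \<in> {1..n}" using v run \<sigma>_range[OF \<sigma> \<tau> assms] \<sigma>_range[OF \<sigma> \<tau>, of i] i
      by (auto simp: below_run_def)
    then obtain x where x: "x \<in> {1..n}" "\<sigma> x = v" using Sym_surj[OF \<sigma>] by blast
    have "x < i"
    proof (cases "v = \<sigma> p")
      case True
      then show ?thesis using x Sym_inj[OF \<sigma>, of x p] run by (simp add: below_run_def)
    next
      case False
      then have "\<sigma> p < \<sigma> x \<and> \<sigma> x < \<sigma> i" using x v run by (auto simp: below_run_def)
      then show ?thesis using run x by (auto simp: below_run_def)
    qed
    then show "v \<in> \<sigma> ` {1..<i}" using x by auto
  qed
  moreover have "\<sigma> i - \<sigma> p < \<sigma> i" using run \<sigma>_range[OF \<sigma> \<tau> assms] by (auto simp: below_run_def)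
  ultimately have "\<sigma> i - \<sigma> p \<le> depth" using depth_iff by blast
  then show "\<sigma> i - depth \<le> \<sigma> p \<and> \<sigma> p < \<sigma> i" using run by (auto simp: below_run_def)
next
  assume p: "\<sigma> i - depth \<le> \<sigma> p \<and> \<sigma> p < \<sigma> i"
  have left: "x < i" if "\<sigma> p \<le> \<sigma> x" "\<sigma> x < \<sigma> i" for x
  proof -
    have "\<sigma> x \<in> {\<sigma> i - depth..<\<sigma> i}" using p that by auto
    then obtain y where "y \<in> {1..<i}" "\<sigma> x = \<sigma> y" using depth_values by blast
    then show ?thesis using Sym_inj[OF \<sigma>, of x y] by simp
  qed
  then show "below_run \<sigma> p" using p by (auto simp: below_run_def)
qed

lemma above_run_iff:
  assumes "q \<in> {1..n}"
  shows "above_run \<sigma> q \<longleftrightarrow> \<sigma> i < \<sigma> q \<and> \<sigma> q \<le> \<sigma> i + height"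
proof
  assume run: "above_run \<sigma> q"
  have "{\<sigma> i<..\<sigma> i + (\<sigma> q - \<sigma> i)} \<subseteq> \<sigma> ` {i<..n}"
  proof
    fix v assume v: "v \<in> {\<sigma> i<..\<sigma> i + (\<sigma> q - \<sigma> i)}"
    have "v \<in> {1..n}" using v run \<sigma>_range[OF \<sigma> \<tau> assms] by (auto simp: above_run_def)
    then obtain x where x: "x \<in> {1..n}" "\<sigma> x = v" using Sym_surj[OF \<sigma>] by blast
    have "i < x"
    proof (cases "v = \<sigma> q")
      case True
      then show ?thesis using x Sym_inj[OF \<sigma>, of x q] run by (simp add: above_run_def)
    next
      case False
      then have "\<sigma> i < \<sigma> x \<and> \<sigma> x < \<sigma> q" using x v run by (auto simp: above_run_def)
      then show ?thesis using run x by (auto simp: above_run_def)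
    qed
    then show "v \<in> \<sigma> ` {i<..n}" using x by auto
  qed
  moreover have "\<sigma> i + (\<sigma> q - \<sigma> i) \<le> n" using run \<sigma>_range[OF \<sigma> \<tau> assms] by (auto simp: above_run_def)
  ultimately have "\<sigma> q - \<sigma> i \<le> height" using height_iff by blast
  then show "\<sigma> i < \<sigma> q \<and> \<sigma> q \<le> \<sigma> i + height" using run by (auto simp: above_run_def)
next
  assume q: "\<sigma> i < \<sigma> q \<and> \<sigma> q \<le> \<sigma> i + height"
  have right: "i < x" if "\<sigma> i < \<sigma> x" "\<sigma> x \<le> \<sigma> q" for x
  proof -
    have "\<sigma> x \<in> {\<sigma> i<..\<sigma> i + height}" using q that by auto
    then obtain y where "y \<in> {i<..n}" "\<sigma> x = \<sigma> y" using height_values by blast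
    then show ?thesis using Sym_inj[OF \<sigma>, of x y] by simp
  qed
  then show "above_run \<sigma> q" using q by (auto simp: above_run_def)
qed

text \<open>The relabelling of values that turns \<open>B n m i \<sigma> \<tau>\<close> into the upper bound.  In \<open>B\<close> the
  values from \<open>s - k\<close> to \<open>e + l\<close> are, in increasing order, the lower run, the block and the upper
  run.  The relabelling rearranges them into: smallest block value, upper run, middle of the block,
  lower run, largest block value.\<close>
definition shift :: "nat \<Rightarrow> nat" where
  "shift v = (let s = \<sigma> i; e = s + m - 1; k = depth; l = height in
     if v < s - k \<or> e + l < v then v
     else if v < s then v + (l + m - 1)
     else if v = s then s - k
     else if v < e then v - k + l
     else if v = e then e + l
     else v - (m - 1 + k))"

definition upper :: "nat \<Rightarrow> nat" where "upper P = shift (B n m i \<sigma> \<tau> P)"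

abbreviation "b \<equiv> B n m i \<sigma> \<tau>"

lemma left_values:
  assumes "P \<in> {1..<i}"
  shows "\<not> below_run \<sigma> P \<and> (b P < \<sigma> i - depth \<or> \<sigma> i + m - 1 + height < b P) \<or>
    below_run \<sigma> P \<and> \<sigma> i - depth \<le> b P \<and> b P < \<sigma> i"
proof -
  have P: "P \<in> {1..n}" using assms i by auto
  have "\<not> above_run \<sigma> P" using assms by (simp add: above_run_def)
  then show ?thesis
    using below_run_iff[OF P] above_run_iff[OF P] Sym_inj[OF \<sigma>, of P i] assms m
    by (auto simp: B_left)
qed

lemma right_values:
  assumes "P \<in> {i + m..<n + m}"
  shows "\<not> above_run \<sigma> (slot P) \<and> (b P < \<sigma> i - depth \<or> \<sigma> i + m - 1 + height < b P) \<or>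
    above_run \<sigma> (slot P) \<and> \<sigma> i + m - 1 < b P \<and> b P \<le> \<sigma> i + m - 1 + height"
proof -
  define q where "q = slot P"
  have q: "q \<in> {i<..n}" "q \<in> {1..n}" "P = q + m - 1" using assms m by (auto simp: q_def slot_def)
  have "\<not> below_run \<sigma> q" using q by (simp add: below_run_def)
  then have "\<not> above_run \<sigma> q \<and> (b P < \<sigma> i - depth \<or> \<sigma> i + m - 1 + height < b P) \<or>
    above_run \<sigma> q \<and> \<sigma> i + m - 1 < b P \<and> b P \<le> \<sigma> i + m - 1 + height"
  proof -
    have bP: "b P = (if \<sigma> q < \<sigma> i then \<sigma> q else \<sigma> q + m - 1)"
      unfolding q(3) by (rule B_right[OF q(1)])
    have "\<sigma> q \<noteq> \<sigma> i" using Sym_inj[OF \<sigma>, of q i] q(1) by simp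
    moreover assume "\<not> below_run \<sigma> q"
    ultimately show ?thesis
      unfolding above_run_iff[OF q(2)] below_run_iff[OF q(2)] bP using m by (cases "\<sigma> q < \<sigma> i") auto
  qed
  then show ?thesis by (simp add: q_def)
qed

lemma block_values:
  assumes "P \<in> block"
  shows "\<sigma> i \<le> b P \<and> b P \<le> \<sigma> i + m - 1" "b P = \<sigma> i \<longleftrightarrow> \<tau> (P + 1 - i) = 1"
    "b P = \<sigma> i + m - 1 \<longleftrightarrow> \<tau> (P + 1 - i) = m"
  using \<tau>_range[OF \<sigma> \<tau> assms] m depth_less by (auto simp: B_block[OF assms])

context
  assumes m2: "1 < m"
begin

lemma shift_low: "v < \<sigma> i - depth \<Longrightarrow> shift v = v"
  and shift_high: "\<sigma> i + m - 1 + height < v \<Longrightarrow> shift v = v"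
  and shift_below: "\<sigma> i - depth \<le> v \<Longrightarrow> v < \<sigma> i \<Longrightarrow> shift v = v + (height + m - 1)"
  and shift_min: "shift (\<sigma> i) = \<sigma> i - depth"
  and shift_mid: "\<sigma> i < v \<Longrightarrow> v < \<sigma> i + m - 1 \<Longrightarrow> shift v = v - depth + height"
  and shift_max: "shift (\<sigma> i + m - 1) = \<sigma> i + m - 1 + height"
  and shift_above: "\<sigma> i + m - 1 < v \<Longrightarrow> v \<le> \<sigma> i + m - 1 + height \<Longrightarrow> shift v = v - (m - 1 + depth)"
  using m2 depth_less by (auto simp: shift_def Let_def)

lemma shift_cases:
  obtains "v < \<sigma> i - depth" "shift v = v" | "\<sigma> i + m - 1 + height < v" "shift v = v"
    | "\<sigma> i - depth \<le> v" "v < \<sigma> i" "shift v = v + (height + m - 1)"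
    | "v = \<sigma> i" "shift v = \<sigma> i - depth"
    | "\<sigma> i < v" "v < \<sigma> i + m - 1" "shift v = v - depth + height"
    | "v = \<sigma> i + m - 1" "shift v = \<sigma> i + m - 1 + height"
    | "\<sigma> i + m - 1 < v" "v \<le> \<sigma> i + m - 1 + height" "shift v = v - (m - 1 + depth)"
proof -
  consider "v < \<sigma> i - depth" | "\<sigma> i + m - 1 + height < v" | "\<sigma> i - depth \<le> v" "v < \<sigma> i"
    | "v = \<sigma> i" | "\<sigma> i < v" "v < \<sigma> i + m - 1" | "v = \<sigma> i + m - 1"
    | "\<sigma> i + m - 1 < v" "v \<le> \<sigma> i + m - 1 + height"
    by linarith
  then show thesis
    by cases (use that shift_low shift_high shift_below shift_min shift_mid shift_max shift_above in blast)+
qed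

lemma upper_left:
  assumes "P \<in> {1..<i}"
  shows "\<not> below_run \<sigma> P \<and> upper P = b P \<and> (b P < \<sigma> i - depth \<or> \<sigma> i + m - 1 + height < b P) \<or>
    below_run \<sigma> P \<and> upper P = b P + (height + m - 1) \<and> \<sigma> i - depth \<le> b P \<and> b P < \<sigma> i"
  using left_values[OF assms] shift_low shift_high shift_below unfolding upper_def by blast

lemma upper_right:
  assumes "P \<in> {i + m..<n + m}"
  shows "\<not> above_run \<sigma> (slot P) \<and> upper P = b P \<and> (b P < \<sigma> i - depth \<or> \<sigma> i + m - 1 + height < b P) \<or>
    above_run \<sigma> (slot P) \<and> upper P = b P - (m - 1 + depth) \<and>
      \<sigma> i + m - 1 < b P \<and> b P \<le> \<sigma> i + m - 1 + height"
  using right_values[OF assms] shift_low shift_high shift_above unfolding upper_def by blast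

lemma upper_block:
  assumes "P \<in> block"
  shows "b P = \<sigma> i \<and> upper P = \<sigma> i - depth \<or>
    b P = \<sigma> i + m - 1 \<and> upper P = \<sigma> i + m - 1 + height \<or>
    \<sigma> i < b P \<and> b P < \<sigma> i + m - 1 \<and> upper P = b P - depth + height"
proof -
  consider "b P = \<sigma> i" | "b P = \<sigma> i + m - 1" | "\<sigma> i < b P" "b P < \<sigma> i + m - 1"
    using block_values(1)[OF assms] by linarith
  then show ?thesis
    by cases (simp_all only: upper_def shift_min shift_max shift_mid simp_thms)
qed

text \<open>Within each of the three parts the relabelling is increasing, so the only pairs that change
  their order are those of \<open>extra_inv\<close>.  The strict inequality in the second case also gives
  injectivity of \<open>upper\<close>.\<close>
lemma upper_compare:
  assumes P: "P \<in> {1..N}" and Q: "Q \<in> {1..N}" and PQ: "P < Q"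
  shows "if b Q < b P \<or> extra_inv \<sigma> \<tau> P Q then upper Q < upper P else upper P < upper Q"
proof -
  \<comment> \<open>Without truncated subtraction the cases below are linear arithmetic.\<close>
  obtain d where d: "\<sigma> i = d + depth" "0 < d" using that[of "\<sigma> i - depth"] depth_less by simp
  obtain r where r: "m = r + 2" using that[of "m - 2"] m2 by simp
  have slotl: "slot R = R" if "R \<in> {1..<i}" for R using that by (simp add: slot_def)
  have above_l: "\<not> above_run \<sigma> (slot R)" if "R \<in> {1..<i} \<or> R \<in> block" for R
    using that by (auto simp: above_run_def slot_def)
  have below_r: "\<not> below_run \<sigma> (slot R)" if "R \<in> block \<or> R \<in> {i + m..<n + m}" for R
    using that m by (auto simp: below_run_def slot_def)
  have nb: "R \<notin> block" if "R \<in> {1..<i} \<or> R \<in> {i + m..<n + m}" for R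
    using that by auto
  have bne: "b P \<noteq> b Q" using PQ Sym_inj[OF B_Sym[OF \<sigma> \<tau>], of P Q] by simp
  consider "P \<in> {1..<i}" "Q \<in> {1..<i}" | "P \<in> {1..<i}" "Q \<in> block"
    | "P \<in> {1..<i}" "Q \<in> {i + m..<n + m}" | "P \<in> block" "Q \<in> block"
    | "P \<in> block" "Q \<in> {i + m..<n + m}" | "P \<in> {i + m..<n + m}" "Q \<in> {i + m..<n + m}"
  proof -
    have cls: "R \<in> {1..<i} \<or> R \<in> block \<or> R \<in> {i + m..<n + m}" if "R \<in> {1..N}" for R
      using that by auto
    have "\<not> (P \<in> block \<and> Q \<in> {1..<i})" "\<not> (P \<in> {i + m..<n + m} \<and> Q \<in> {1..<i})"
      "\<not> (P \<in> {i + m..<n + m} \<and> Q \<in> block)"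
      using PQ by auto
    then show thesis using that cls[OF P] cls[OF Q] by blast
  qed
  then show ?thesis
  proof cases
    case 1
    then have "\<not> extra_inv \<sigma> \<tau> P Q" using above_l nb unfolding extra_inv_def by blast
    then show ?thesis
      using upper_left[OF 1(1)] upper_left[OF 1(2)] bne unfolding d(1) r
      by (elim disjE conjE) auto
  next
    case 2
    then have "extra_inv \<sigma> \<tau> P Q \<longleftrightarrow> below_run \<sigma> P \<and> b Q \<noteq> \<sigma> i + m - 1"
      using above_l nb block_values(3)[OF 2(2)] unfolding extra_inv_def by (metis slotl)
    then show ?thesis
      using upper_left[OF 2(1)] upper_block[OF 2(2)] bne d(2) unfolding d(1) r
      by (elim disjE conjE) auto
  next
    case 3
    then have "extra_inv \<sigma> \<tau> P Q \<longleftrightarrow> below_run \<sigma> P \<and> above_run \<sigma> (slot Q)"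
      using nb m2 unfolding extra_inv_def by (metis slotl)
    then show ?thesis
      using upper_left[OF 3(1)] upper_right[OF 3(2)] bne d(2) unfolding d(1) r
      by (elim disjE conjE) auto
  next
    case 4
    then have "\<not> extra_inv \<sigma> \<tau> P Q" using above_l below_r unfolding extra_inv_def by blast
    then show ?thesis
      using upper_block[OF 4(1)] upper_block[OF 4(2)] bne d(2) unfolding d(1) r
      by (elim disjE conjE) auto
  next
    case 5
    then have "extra_inv \<sigma> \<tau> P Q \<longleftrightarrow> above_run \<sigma> (slot Q) \<and> b P \<noteq> \<sigma> i"
      using below_r nb block_values(2)[OF 5(1)] unfolding extra_inv_def by metis
    then show ?thesis
      using upper_block[OF 5(1)] upper_right[OF 5(2)] bne d(2) unfolding d(1) r
      by (elim disjE conjE) auto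
  next
    case 6
    then have "\<not> extra_inv \<sigma> \<tau> P Q" using below_r nb unfolding extra_inv_def by blast
    then show ?thesis
      using upper_right[OF 6(1)] upper_right[OF 6(2)] bne d(2) unfolding d(1) r
      by (elim disjE conjE) auto
  qed
qed

lemma upper_less_iff:
  "P \<in> {1..N} \<Longrightarrow> Q \<in> {1..N} \<Longrightarrow> P < Q \<Longrightarrow>
    upper Q < upper P \<longleftrightarrow> b Q < b P \<or> extra_inv \<sigma> \<tau> P Q"
  using upper_compare[of P Q] by (auto split: if_splits)

lemma upper_Sym: "upper \<in> Sym N"
proof (rule Sym_I)
  fix P assume "P \<in> {1..N}"
  then have "b P \<in> {1..N}" using Sym_in[OF B_Sym[OF \<sigma> \<tau>]] by blast
  then show "upper P \<in> {1..N}"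
    using height_le depth_less m2 unfolding upper_def by (cases "b P" rule: shift_cases) auto
next
  show "inj_on upper {1..N}"
  proof (rule linorder_inj_onI)
    fix P Q assume "P < Q" "P \<in> {1..N}" "Q \<in> {1..N}"
    then show "upper P \<noteq> upper Q" using upper_compare[of P Q] by (auto split: if_splits)
  qed auto
next
  fix P assume P: "P \<notin> {1..N}"
  then have "b P = P" using B_Sym[OF \<sigma> \<tau>] permutes_not_in[of b "{1..N}" P] by (simp add: Sym_def)
  moreover have "shift P = P"
  proof (cases "P = 0")
    case True
    then show ?thesis using depth_less by (intro shift_low) simp
  next
    case False
    then have "N < P" using P by simp
    then show ?thesis using height_le m2 by (intro shift_high) linarith
  qed
  ultimately show "upper P = P" by (simp add: upper_def)
qed

definition satisfies_T :: "(nat \<Rightarrow> nat) \<Rightarrow> bool" where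
  "satisfies_T \<rho> \<longleftrightarrow> \<rho> \<in> Sym N \<and>
     st (seq1 n m i \<rho>) = st (seq1 n m i b) \<and>
     st (seq2 n m i \<rho>) = st (seq2 n m i b) \<and>
     st (seq3 n m i \<rho>) = st (seq3 n m i b) \<and>
     set (seq1 n m i \<rho>) = {x \<in> set (seq1 n m i b). x < int (\<sigma> i) - int depth} \<union>
       {int (\<sigma> i) + int m - 1 + int height - int depth..int (\<sigma> i) + int m - 1 + int height - 1} \<union>
       {x \<in> set (seq1 n m i b). x > int (\<sigma> i)} \<and>
     set (seq2 n m i \<rho>) = {int (\<sigma> i) - int depth} \<union>
       {int (\<sigma> i) - int depth + int height + 1..int (\<sigma> i) + int m - 1 + int height - int depth - 1} \<union>
       {int (\<sigma> i) + int m - 1 + int height} \<and>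
     set (seq3 n m i \<rho>) = {x \<in> set (seq3 n m i b). x < int (\<sigma> i) + int m - 1} \<union>
       {int (\<sigma> i) - int depth + 1..int (\<sigma> i) - int depth + int height} \<union>
       {x \<in> set (seq3 n m i b). x > int (\<sigma> i) + int m - 1 + int height}"

lemma T_eq_The: "T n m i \<sigma> \<tau> = (THE \<rho>. satisfies_T \<rho>)"
  using m2 unfolding T_def Let_def satisfies_T_def depth_def height_def by simp

lemma satisfies_T_unique: "satisfies_T \<pi> \<Longrightarrow> satisfies_T \<rho> \<Longrightarrow> \<pi> = \<rho>"
  unfolding satisfies_T_def by (rule eq_if_seq_eq) simp_all

lemma b_left_preimage:
  assumes "\<sigma> i - depth \<le> v" "v < \<sigma> i"
  shows "\<exists>P\<in>{1..<i}. b P = v"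
proof -
  have "v \<in> \<sigma> ` {1..<i}" using assms depth_values by auto
  then obtain P where "P \<in> {1..<i}" "v = \<sigma> P" by blast
  then show ?thesis using assms B_left[of P] by auto
qed

lemma b_right_preimage:
  assumes "\<sigma> i + m - 1 < v" "v \<le> \<sigma> i + m - 1 + height"
  shows "\<exists>P\<in>{i + m..<n + m}. b P = v"
proof -
  have "v + 1 - m \<in> {\<sigma> i<..\<sigma> i + height}" using assms m by auto
  then have "v + 1 - m \<in> \<sigma> ` {i<..n}" using height_values by blast
  then obtain q where q: "q \<in> {i<..n}" "v + 1 - m = \<sigma> q" by blast
  then have "b (q + m - 1) = v" using assms m by (subst B_right) auto
  moreover have "q + m - 1 \<in> {i + m..<n + m}" using q m by auto
  ultimately show ?thesis by blast
qed

lemma b_block_preimage: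
  assumes "\<sigma> i \<le> v" "v \<le> \<sigma> i + m - 1"
  shows "\<exists>P\<in>block. b P = v"
proof -
  have "v + 1 - \<sigma> i \<in> {1..m}" using assms m by auto
  then obtain k where k: "k \<in> {1..m}" "\<tau> k = v + 1 - \<sigma> i" using Sym_surj[OF \<tau>] by blast
  have P: "k + i - 1 \<in> block" using k i by auto
  have "b (k + i - 1) = v" unfolding B_block[OF P] using k i assms by simp
  then show ?thesis using P by blast
qed

lemma set_seq1_upper:
  "set (seq1 n m i upper) = {x \<in> set (seq1 n m i b). x < int (\<sigma> i) - int depth} \<union>
     {int (\<sigma> i) + int m - 1 + int height - int depth..int (\<sigma> i) + int m - 1 + int height - 1} \<union>
     {x \<in> set (seq1 n m i b). x > int (\<sigma> i)}" (is "_ = ?R")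
proof (intro equalityI subsetI)
  fix x assume "x \<in> set (seq1 n m i upper)"
  then obtain P where P: "P \<in> {1..<i}" "x = int (upper P)" unfolding set_seq by blast
  have "int (b P) \<in> set (seq1 n m i b)" unfolding set_seq using P by blast
  moreover have "upper P = b P \<and> b P < \<sigma> i - depth \<or> upper P = b P \<and> \<sigma> i < b P \<or>
      \<sigma> i + m - 1 + height - depth \<le> upper P \<and> upper P < \<sigma> i + m - 1 + height"
    using upper_left[OF P(1)] m2 depth_less by (elim disjE conjE) auto
  ultimately show "x \<in> ?R" using P(2) depth_less m2 by auto
next
  fix x assume "x \<in> ?R"
  then consider P where "P \<in> {1..<i}" "x = int (b P)" "x < int (\<sigma> i) - int depth \<or> x > int (\<sigma> i)"
    | "\<sigma> i + m - 1 + height - depth \<le> nat x" "nat x < \<sigma> i + m - 1 + height" "x = int (nat x)"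
    unfolding set_seq using depth_less m2 by fastforce
  then show "x \<in> set (seq1 n m i upper)"
  proof cases
    case 1
    then have "b P < \<sigma> i - depth \<or> \<sigma> i < b P" using m2 by linarith
    then have "upper P = b P"
      using upper_left[OF 1(1)] m2 depth_less by (elim disjE conjE) auto
    then have "x = int (upper P)" using 1(2) by simp
    then show ?thesis unfolding set_seq using 1(1) by blast
  next
    case 2
    define v where "v = nat x - (height + m - 1)"
    have v: "\<sigma> i - depth \<le> v" "v < \<sigma> i" "nat x = v + (height + m - 1)"
      using 2(1,2) depth_less m2 by (simp_all add: v_def)
    obtain P where P: "P \<in> {1..<i}" "b P = v" using b_left_preimage[OF v(1,2)] by blast
    have "x = int (upper P)"
      using 2(3) shift_below[OF v(1,2)] v(3) by (simp add: upper_def P(2))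
    then show ?thesis unfolding set_seq using P(1) by blast
  qed
qed

lemma set_seq2_upper:
  "set (seq2 n m i upper) = {int (\<sigma> i) - int depth} \<union>
     {int (\<sigma> i) - int depth + int height + 1..int (\<sigma> i) + int m - 1 + int height - int depth - 1} \<union>
     {int (\<sigma> i) + int m - 1 + int height}" (is "_ = ?R")
proof (intro equalityI subsetI)
  fix x assume "x \<in> set (seq2 n m i upper)"
  then obtain P where P: "P \<in> block" "x = int (upper P)" unfolding set_seq by blast
  obtain d where d: "\<sigma> i = d + depth" "0 < d" using that[of "\<sigma> i - depth"] depth_less by simp
  obtain r where r: "m = r + 2" using that[of "m - 2"] m2 by simp
  have "upper P = \<sigma> i - depth \<or> upper P = \<sigma> i + m - 1 + height \<or>
      \<sigma> i - depth + height < upper P \<and> upper P < \<sigma> i + m - 1 + height - depth"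
    using upper_block[OF P(1)] d(2) unfolding d(1) r by (elim disjE conjE) auto
  then show "x \<in> ?R" using P(2) depth_less m2 by auto
next
  fix x assume "x \<in> ?R"
  then consider "x = int (\<sigma> i - depth)" | "x = int (\<sigma> i + m - 1 + height)"
    | "\<sigma> i - depth + height < nat x" "nat x < \<sigma> i + m - 1 + height - depth" "x = int (nat x)"
    using depth_less m2 by fastforce
  then obtain v where "\<sigma> i \<le> v" "v \<le> \<sigma> i + m - 1" "x = int (shift v)"
  proof cases
    case 1
    show thesis by (rule that[of "\<sigma> i"]) (use 1 m2 shift_min in auto)
  next
    case 2
    show thesis by (rule that[of "\<sigma> i + m - 1"]) (use 2 m2 shift_max in auto)
  next
    case 3
    define v where "v = nat x + depth - height"
    have v: "\<sigma> i < v" "v < \<sigma> i + m - 1" "nat x = v - depth + height"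
      using 3(1,2) depth_less m2 by (simp_all add: v_def)
    show thesis by (rule that[of v]) (use v 3(3) shift_mid[OF v(1,2)] in simp_all)
  qed
  then show "x \<in> set (seq2 n m i upper)"
    unfolding set_seq upper_def using b_block_preimage[of v] by auto
qed

lemma set_seq3_upper:
  "set (seq3 n m i upper) = {x \<in> set (seq3 n m i b). x < int (\<sigma> i) + int m - 1} \<union>
     {int (\<sigma> i) - int depth + 1..int (\<sigma> i) - int depth + int height} \<union>
     {x \<in> set (seq3 n m i b). x > int (\<sigma> i) + int m - 1 + int height}" (is "_ = ?R")
proof (intro equalityI subsetI)
  fix x assume "x \<in> set (seq3 n m i upper)"
  then obtain P where P: "P \<in> {i + m..<n + m}" "x = int (upper P)" unfolding set_seq by blast
  have "int (b P) \<in> set (seq3 n m i b)" unfolding set_seq using P by blast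
  moreover have "upper P = b P \<and> b P < \<sigma> i \<or> upper P = b P \<and> \<sigma> i + m - 1 + height < b P \<or>
      \<sigma> i - depth < upper P \<and> upper P \<le> \<sigma> i - depth + height"
    using upper_right[OF P(1)] m2 depth_less by (elim disjE conjE) auto
  ultimately show "x \<in> ?R" using P(2) depth_less m2 by auto
next
  fix x assume "x \<in> ?R"
  then consider P where "P \<in> {i + m..<n + m}" "x = int (b P)"
      "x < int (\<sigma> i) + int m - 1 \<or> x > int (\<sigma> i) + int m - 1 + int height"
    | "\<sigma> i - depth < nat x" "nat x \<le> \<sigma> i - depth + height" "x = int (nat x)"
    unfolding set_seq using depth_less m2 by fastforce
  then show "x \<in> set (seq3 n m i upper)"
  proof cases
    case 1
    then have "b P < \<sigma> i + m - 1 \<or> \<sigma> i + m - 1 + height < b P" using m2 by linarith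
    then have "upper P = b P"
      using upper_right[OF 1(1)] m2 depth_less by (elim disjE conjE) auto
    then have "x = int (upper P)" using 1(2) by simp
    then show ?thesis unfolding set_seq using 1(1) by blast
  next
    case 2
    define v where "v = nat x + (m - 1 + depth)"
    have v: "\<sigma> i + m - 1 < v" "v \<le> \<sigma> i + m - 1 + height" "nat x = v - (m - 1 + depth)"
      using 2(1,2) depth_less m2 by (simp_all add: v_def)
    obtain P where P: "P \<in> {i + m..<n + m}" "b P = v" using b_right_preimage[OF v(1,2)] by blast
    have "x = int (upper P)"
      using 2(3) shift_above[OF v(1,2)] v(3) by (simp add: upper_def P(2))
    then show ?thesis unfolding set_seq using P(1) by blast
  qed
qed

lemma st_upper:
  "st (seq1 n m i upper) = st (seq1 n m i b)"
  "st (seq2 n m i upper) = st (seq2 n m i b)"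
  "st (seq3 n m i upper) = st (seq3 n m i b)"
proof -
  have less: "upper P < upper Q \<longleftrightarrow> b P < b Q"
    if "P \<in> {1..N}" "Q \<in> {1..N}" "P < Q \<Longrightarrow> \<not> extra_inv \<sigma> \<tau> P Q" "Q < P \<Longrightarrow> \<not> extra_inv \<sigma> \<tau> Q P" for P Q
    using that upper_less_iff[OF that(1,2)] upper_less_iff[OF that(2,1)]
      Sym_inj[OF upper_Sym, of P Q] Sym_inj[OF B_Sym[OF \<sigma> \<tau>], of P Q]
    by (cases P Q rule: linorder_cases) (auto simp: not_less_iff_gr_or_eq)
  have run_pos: "P < i" if "below_run \<sigma> (slot P)" for P
    using that m by (auto simp: below_run_def slot_def split: if_splits)
  have run_pos': "i + m \<le> P" if "above_run \<sigma> (slot P)" for P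
    using that m by (auto simp: above_run_def slot_def split: if_splits)
  have "upper P < upper Q \<longleftrightarrow> b P < b Q" if "P \<in> {1..<i}" "Q \<in> {1..<i}" for P Q
  proof (rule less)
    show "\<not> extra_inv \<sigma> \<tau> P Q" "\<not> extra_inv \<sigma> \<tau> Q P"
      using that run_pos' by (fastforce simp: extra_inv_def)+
  qed (use that i m in auto)
  then show "st (seq1 n m i upper) = st (seq1 n m i b)"
    by (intro st_cong) (auto simp: seq1_def)
  have "upper P < upper Q \<longleftrightarrow> b P < b Q" if "P \<in> block" "Q \<in> block" for P Q
  proof (rule less)
    show "\<not> extra_inv \<sigma> \<tau> P Q" "\<not> extra_inv \<sigma> \<tau> Q P"
      using that run_pos run_pos' by (fastforce simp: extra_inv_def)+
  qed (use that block_in in blast)+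
  then show "st (seq2 n m i upper) = st (seq2 n m i b)"
    by (intro st_cong) (auto simp: seq2_def)
  have "upper P < upper Q \<longleftrightarrow> b P < b Q" if "P \<in> {i + m..<n + m}" "Q \<in> {i + m..<n + m}" for P Q
  proof (rule less)
    show "\<not> extra_inv \<sigma> \<tau> P Q" "\<not> extra_inv \<sigma> \<tau> Q P"
      using that run_pos by (fastforce simp: extra_inv_def)+
  qed (use that i m in auto)
  then show "st (seq3 n m i upper) = st (seq3 n m i b)"
    by (intro st_cong) (auto simp: seq3_def)
qed

lemma T_eq_upper: "T n m i \<sigma> \<tau> = upper"
proof -
  have sat: "satisfies_T upper"
    unfolding satisfies_T_def
    by (intro conjI upper_Sym st_upper set_seq1_upper set_seq2_upper set_seq3_upper)
  show ?thesis
    unfolding T_eq_The by (rule the_equality[where P = satisfies_T, OF sat]) (rule satisfies_T_unique[OF _ sat])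
qed

end

lemma T_Sym: "T n m i \<sigma> \<tau> \<in> Sym N"
  and T_less_iff: "P \<in> {1..N} \<Longrightarrow> Q \<in> {1..N} \<Longrightarrow> P < Q \<Longrightarrow>
    T n m i \<sigma> \<tau> Q < T n m i \<sigma> \<tau> P \<longleftrightarrow> b Q < b P \<or> extra_inv \<sigma> \<tau> P Q"
proof -
  have "T n m i \<sigma> \<tau> \<in> Sym N \<and> (P \<in> {1..N} \<longrightarrow> Q \<in> {1..N} \<longrightarrow> P < Q \<longrightarrow>
    (T n m i \<sigma> \<tau> Q < T n m i \<sigma> \<tau> P \<longleftrightarrow> b Q < b P \<or> extra_inv \<sigma> \<tau> P Q))" for P Q
  proof (cases "1 < m")
    case True
    then show ?thesis using upper_Sym upper_less_iff T_eq_upper by simp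
  next
    case False
    then have m1: "m = 1" using m by simp
    \<comment> \<open>A block with one entry leaves nothing to pass: its entry is both smallest and largest.\<close>
    have slot: "slot P = P" for P unfolding slot_def unfolding m1 by simp
    have no_extra: "\<not> extra_inv \<sigma> \<tau> P Q"
      using \<tau>_range[OF \<sigma> \<tau>, of P] \<tau>_range[OF \<sigma> \<tau>, of Q] m1 unfolding extra_inv_def by fastforce
    have "T n m i \<sigma> \<tau> = \<sigma>" by (simp add: T_def m1)
    moreover have "b Q < b P \<longleftrightarrow> \<sigma> Q < \<sigma> P" if "P \<in> {1..N}" "Q \<in> {1..N}" "P < Q"
      using that m1 unfolding B_less_iff[OF \<sigma> \<tau> that(2,1)] slot by auto
    ultimately show ?thesis using \<sigma> m1 no_extra by simp
  qed
  then show "T n m i \<sigma> \<tau> \<in> Sym N" and "P \<in> {1..N} \<Longrightarrow> Q \<in> {1..N} \<Longrightarrow> P < Q \<Longrightarrow>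
    T n m i \<sigma> \<tau> Q < T n m i \<sigma> \<tau> P \<longleftrightarrow> b Q < b P \<or> extra_inv \<sigma> \<tau> P Q"
    by blast+
qed

end

section \<open>The product in the basis M\<close>

theorem theorem1p1:
  fixes n m i :: nat and \<sigma> \<tau> :: "nat \<Rightarrow> nat"
  assumes "n \<ge> 1" and "m \<ge> 1"
    and "\<sigma> \<in> Sym n" and "\<tau> \<in> Sym m"
    and "1 \<le> i" and "i \<le> n"
  shows "partial_comp n m i (M n \<sigma>) (M m \<tau>) =
    (\<Sum>\<rho> | (B n m i \<sigma> \<tau>, \<rho>) \<in> weak_order (n + m - 1) \<and>
           (\<rho>, T n m i \<sigma> \<tau>) \<in> weak_order (n + m - 1).
       (M (n + m - 1) \<rho> :: (nat \<Rightarrow> nat) \<Rightarrow>\<^sub>0 'k::comm_ring_1))"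
proof -
  let ?N = "n + m - 1"
  interpret insertion_pair n m i \<sigma> \<tau> by unfold_locales (fact assms)+
  have "partial_comp n m i (M n \<sigma>) (M m \<tau>) =
      (\<Sum>\<rho> | \<rho> \<in> Sym ?N \<and> \<sigma> = outer \<rho> \<and> \<tau> = inner \<rho>. (M ?N \<rho> :: _ \<Rightarrow>\<^sub>0 'k))"
    using assms(3,4) B_Sym adjunction by (rule partial_comp_M_M)
  moreover have "\<rho> \<in> Sym ?N \<and> \<sigma> = outer \<rho> \<and> \<tau> = inner \<rho> \<longleftrightarrow>
      (B n m i \<sigma> \<tau>, \<rho>) \<in> weak_order ?N \<and> (\<rho>, T n m i \<sigma> \<tau>) \<in> weak_order ?N" for \<rho>
  proof (cases "\<rho> \<in> Sym ?N")
    case True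
    show ?thesis using interval_iff[OF assms(3,4) True T_Sym T_less_iff] True by blast
  next
    case False
    then show ?thesis by (auto simp: weak_order_iff)
  qed
  ultimately show ?thesis by simp
qed

end
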